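(* Let $(X,\mathcal{F},\mu)$ be a probability space and let $S_n : \mathcal{M}(X) \to \mathcal{M}(X)$, $n \in \mathbb{N}$, be linear operators such that each $S_n : L^2(\mu) \to L^2(\mu)$ is bounded (not necessarily uniformly in $n$). Assume that $(S_n)$ commutes with a Bourgain sequence $(T_j)_{j\in\mathbb{N}}$ on $(X,\mathcal{F},\mu)$, i.e. $S_n T_j = T_j S_n$ for all $n, j$. Suppose that for some $1 \le p < \infty$, $\sup_n |S_n f| < \infty$ $\mu$-almost surely for every $f \in L^p(\mu)$. Then there exists a constant $C > 0$ such that $$\delta \,\bigl(\log N_f(\delta)\bigr)^{1/2} \le C \,\|f\|_{L^2(\mu)} \quad \text{for all } \delta > 0 \text{ and all } f \in L^2(\mu).$$
   Context: $(X,\mathcal{F},\mu)$ is a probability space; $\mathcal{M}(X)$ denotes the set of measurable functions $f : X \to \mathbb{R}$; $L^p(\mu)$ consists of real-valued functions only (the elements of $\mathcal{M}(X)$ with finite $L^p$-norm). Bourgain sequence: a sequence of linear operators $T_j : \mathcal{M}(X) \to \mathcal{M}(X)$, $j \in \mathbb{N}$, such that (1) each $T_j : L^1(\mu) \to L^1(\mu)$ is bounded; (2) each $T_j : L^2(\mu) \to L^2(\mu)$ is an isometry; (3) each $T_j$ is positive, i.e. $f \ge 0$ a.s. implies $T_j f \ge 0$ a.s.; (4) $T_j(1) = 1$, where $1$ is the constant function; (5) the mean ergodic condition holds: $\frac{1}{J}\sum_{j=1}^J T_j f \to \int_X f \, d\mu$ in $L^1(\mu)$-norm as $J \to \infty$,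 for all $f \in L^1(\mu)$. Entropy numbers: for a pseudo-metric space $(Y,d)$ ($d$ need not separate points), a subset $S \subset Y$ and $\delta>0$, $N(S,d,\delta)$ is the minimal number of closed $\delta$-balls in the pseudo-metric $d$ needed to cover $S$. For $f \in L^2(\mu)$ define a pseudo-metric on $\mathbb{N}$ by $d_f(n,n') = \|S_n f - S_{n'} f\|_{L^2(\mu)}$, and set $N_f(\delta) := N(\mathbb{N}, d_f, \delta)$, the $\delta$-entropy number of the set $\{S_n f : n \in \mathbb{N}\}$ in $L^2(\mu)$. *)

theory Defs
  imports "HOL-Probability.Probability" "HOL-Library.Extended_Nat"
begin

text \<open>
  Operators on the measurable functions are modelled as maps on representatives. As usual for
  operators defined modulo null sets, every identity between functions is required almost
  everywhere. The index set \<open>{1..}\<close> plays the role of the natural numbers \<open>1, 2, 3, \<dots>\<close>.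
\<close>

definition Lp_space :: "'a measure \<Rightarrow> real \<Rightarrow> ('a \<Rightarrow> real) set" where
  "Lp_space M p = {f \<in> borel_measurable M. integrable M (\<lambda>x. \<bar>f x\<bar> powr p)}"

definition Lp_norm :: "'a measure \<Rightarrow> real \<Rightarrow> ('a \<Rightarrow> real) \<Rightarrow> real" where
  "Lp_norm M p f = (\<integral>x. \<bar>f x\<bar> powr p \<partial>M) powr (1 / p)"

definition linear_operator :: "'a measure \<Rightarrow> (('a \<Rightarrow> real) \<Rightarrow> 'a \<Rightarrow> real) \<Rightarrow> bool" where
  "linear_operator M T \<longleftrightarrow>
     (\<forall>f \<in> borel_measurable M. T f \<in> borel_measurable M) \<and>
     (\<forall>f \<in> borel_measurable M. \<forall>g \<in> borel_measurable M.
        AE x in M. T (\<lambda>y. f y + g y) x = T f x + T g x) \<and>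
     (\<forall>c. \<forall>f \<in> borel_measurable M. AE x in M. T (\<lambda>y. c * f y) x = c * T f x)"

definition bounded_on_Lp :: "'a measure \<Rightarrow> real \<Rightarrow> (('a \<Rightarrow> real) \<Rightarrow> 'a \<Rightarrow> real) \<Rightarrow> bool" where
  "bounded_on_Lp M p T \<longleftrightarrow>
     (\<forall>f \<in> Lp_space M p. T f \<in> Lp_space M p) \<and>
     (\<exists>K. \<forall>f \<in> Lp_space M p. Lp_norm M p (T f) \<le> K * Lp_norm M p f)"

definition isometry_on_Lp :: "'a measure \<Rightarrow> real \<Rightarrow> (('a \<Rightarrow> real) \<Rightarrow> 'a \<Rightarrow> real) \<Rightarrow> bool" where
  "isometry_on_Lp M p T \<longleftrightarrow>
     (\<forall>f \<in> Lp_space M p. T f \<in> Lp_space M p \<and> Lp_norm M p (T f) = Lp_norm M p f)"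

definition positive_operator :: "'a measure \<Rightarrow> (('a \<Rightarrow> real) \<Rightarrow> 'a \<Rightarrow> real) \<Rightarrow> bool" where
  "positive_operator M T \<longleftrightarrow>
     (\<forall>f \<in> borel_measurable M. (AE x in M. 0 \<le> f x) \<longrightarrow> (AE x in M. 0 \<le> T f x))"

definition bourgain_sequence :: "'a measure \<Rightarrow> (nat \<Rightarrow> ('a \<Rightarrow> real) \<Rightarrow> 'a \<Rightarrow> real) \<Rightarrow> bool" where
  "bourgain_sequence M T \<longleftrightarrow>
     (\<forall>j\<ge>1. linear_operator M (T j)) \<and>
     (\<forall>j\<ge>1. bounded_on_Lp M 1 (T j)) \<and>
     (\<forall>j\<ge>1. isometry_on_Lp M 2 (T j)) \<and>
     (\<forall>j\<ge>1. positive_operator M (T j)) \<and>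
     (\<forall>j\<ge>1. AE x in M. T j (\<lambda>_. 1) x = 1) \<and>
     (\<forall>f \<in> Lp_space M 1.
        (\<lambda>J. Lp_norm M 1 (\<lambda>x. (1 / real J) * (\<Sum>j=1..J. T j f x) - (\<integral>y. f y \<partial>M)))
          \<longlonglongrightarrow> 0)"

definition operators_commute ::
  "'a measure \<Rightarrow> (('a \<Rightarrow> real) \<Rightarrow> 'a \<Rightarrow> real) \<Rightarrow> (('a \<Rightarrow> real) \<Rightarrow> 'a \<Rightarrow> real) \<Rightarrow> bool" where
  "operators_commute M S T \<longleftrightarrow>
     (\<forall>f \<in> borel_measurable M. AE x in M. S (T f) x = T (S f) x)"

text \<open>
  The minimal number of closed \<open>\<delta>\<close>-balls of the pseudo-metric space \<open>(Y, d)\<close> covering \<open>A\<close>;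
  it is \<open>\<infinity>\<close> (the infimum of the empty set) if no finite family of balls covers \<open>A\<close>.
\<close>

definition entropy_number :: "'b set \<Rightarrow> ('b \<Rightarrow> 'b \<Rightarrow> real) \<Rightarrow> 'b set \<Rightarrow> real \<Rightarrow> enat" where
  "entropy_number Y d A \<delta> =
     Inf {enat (card C) | C. finite C \<and> C \<subseteq> Y \<and> A \<subseteq> (\<Union>c\<in>C. {y \<in> Y. d c y \<le> \<delta>})}"

definition orbit_dist ::
  "'a measure \<Rightarrow> (nat \<Rightarrow> ('a \<Rightarrow> real) \<Rightarrow> 'a \<Rightarrow> real) \<Rightarrow> ('a \<Rightarrow> real) \<Rightarrow> nat \<Rightarrow> nat \<Rightarrow> real" where
  "orbit_dist M S f n m = Lp_norm M 2 (\<lambda>x. S n f x - S m f x)"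

definition orbit_entropy ::
  "'a measure \<Rightarrow> (nat \<Rightarrow> ('a \<Rightarrow> real) \<Rightarrow> 'a \<Rightarrow> real) \<Rightarrow> ('a \<Rightarrow> real) \<Rightarrow> real \<Rightarrow> enat" where
  "orbit_entropy M S f \<delta> = entropy_number {1..} (orbit_dist M S f) {1..} \<delta>"

end

theory Submission
  imports Defs
begin

text \<open>
  Bourgain's entropy criterion. The orbit \<open>S n f\<close> is compared with a Gaussian process whose
  size is controlled by the almost sure finiteness of \<open>sup\<^sub>n \<bar>S n f\<bar>\<close> and whose
  intrinsic metric is, up to a small error, the \<open>L\<^sup>2\<close> metric of the orbit.

  For a bounded \<open>f\<close> with \<open>\<parallel>f\<parallel>\<^sub>2 \<le> 1\<close> and independent standard Gaussians \<open>g 1, \<dots>, g J\<close> put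
  \<open>F = (\<Sum>j. g j * T j f) / sqrt J\<close>. For fixed \<open>x\<close> the expectation of \<open>cosh (F x)\<close> is
  \<open>exp (b x / 2)\<close> with \<open>b x = (\<Sum>j. (T j f x)\<^sup>2) / J\<close>. The ergodic condition makes \<open>b\<close> converge
  to \<open>\<parallel>f\<parallel>\<^sub>2\<^sup>2\<close> (\<open>bourgain_square_average\<close>, where positivity and the isometry property enter), so
  \<open>\<integral> cosh F \<le> 48\<close> for most \<open>g\<close>. A Banach principle (\<open>banach_principle\<close>) turns the qualitative
  hypothesis into a number \<open>R\<close> such that every \<open>h\<close> with \<open>\<integral> cosh h \<le> 48\<close> satisfies
  \<open>sup\<^sub>n \<bar>S n h\<bar> \<le> R\<close> outside a set of measure at most \<open>1 / 16\<close>. Hence \<open>sup\<^sub>n \<bar>S n F x\<bar> \<le> R\<close> for most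
  pairs \<open>(g, x)\<close>.

  By commutation, \<open>S n F x = (\<Sum>j. g j * T j (S n f) x) / sqrt J\<close> almost everywhere. For fixed
  \<open>x\<close> this is a Gaussian process in \<open>n\<close>, and its squared metric
  \<open>(\<Sum>j. (T j (S n f - S m f) x)\<^sup>2) / J\<close> is close to \<open>\<parallel>S n f - S m f\<parallel>\<^sub>2\<^sup>2\<close> for most \<open>x\<close>, again by
  \<open>bourgain_square_average\<close>. Fubini provides a single \<open>x\<close> at which the process is both well
  separated and bounded by \<open>R + 1\<close> with probability at least \<open>3 / 4\<close>; Sudakov minoration
  (\<open>sudakov_minoration\<close>) then bounds the number of separated indices
  (\<open>orbit_separation_bound\<close>). Truncation and scaling remove the two normalizations of \<open>f\<close>, and a
  maximal separated set of indices is the set of centres of a covering.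

  The size of functions is measured by \<open>\<integral> cosh\<close> because this one condition implies membership
  in every \<open>L\<^sup>p\<close> with \<open>p < \<infinity>\<close>, so that all exponents are treated at once, and because its Gaussian
  average is explicit.
\<close>

section \<open>Growth of the hyperbolic cosine\<close>

lemma borel_measurable_cosh [measurable]:
  "(cosh :: real \<Rightarrow> real) \<in> borel_measurable borel"
  by (intro borel_measurable_continuous_onI continuous_intros)

lemma cosh_scale:
  fixes t u :: real
  assumes "0 \<le> t" "t \<le> 1"
  shows "cosh (t * u) - 1 \<le> t * (cosh u - 1)"
proof -
  have e: "exp (t * v) \<le> (1 - t) + t * exp v" for v :: real
    using convex_onD[OF exp_convex assms, of 0 v] by simp
  show ?thesis using e[of u] e[of "- u"] by (simp add: cosh_field_def field_simps)
qed

lemma half_square_le_cosh: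
  fixes u :: real
  shows "u\<^sup>2 / 2 \<le> cosh u - 1"
proof -
  have "(\<Sum>n\<in>{0, 2}. if even n then u ^ n /\<^sub>R fact n else 0) \<le> (\<Sum>n. if even n then u ^ n /\<^sub>R fact n else 0)"
    using sums_summable[OF cosh_converges[of u]] by (intro sum_le_suminf) (auto simp: zero_le_even_power)
  also have "\<dots> = cosh u" using sums_unique[OF cosh_converges[of u]] by simp
  finally show ?thesis by (simp add: field_simps)
qed

text \<open>
  A bound for all the values \<open>cosh (2 ^ Suc j * a j)\<close> forces \<open>\<bar>a j\<bar> \<le> b / 2 ^ Suc j\<close> with
  \<open>cosh b = c\<close>, and these bounds add up to exactly \<open>b\<close>. This replaces a triangle inequality for
  the modular \<open>\<integral> (cosh f - 1)\<close>, which is not a norm.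
\<close>

lemma cosh_suminf:
  fixes a :: "nat \<Rightarrow> real"
  assumes "\<And>j. cosh (2 ^ Suc j * a j) \<le> c"
  shows "summable (\<lambda>j. \<bar>a j\<bar>)" and "cosh (\<Sum>j. a j) \<le> c"
proof -
  have c1: "1 \<le> c" using cosh_real_ge_1 assms[of 0] order_trans by blast
  define b where "b = arcosh c"
  have b: "0 \<le> b" "cosh b = c" using c1 by (auto simp: b_def)
  have a: "\<bar>a j\<bar> \<le> b * (1 / 2) ^ Suc j" for j
  proof -
    have "cosh \<bar>2 ^ Suc j * a j\<bar> \<le> cosh b" using assms[of j] b by simp
    then have "\<bar>2 ^ Suc j * a j\<bar> \<le> b" using b(1) by (subst (asm) cosh_real_nonneg_le_iff) auto
    then show ?thesis by (simp add: abs_mult field_simps)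
  qed
  have s: "(\<lambda>j. b * (1 / 2) ^ Suc j) sums (b * 1)"
    by (intro sums_mult power_half_series)
  show sa: "summable (\<lambda>j. \<bar>a j\<bar>)"
    using a s by (intro summable_comparison_test'[OF sums_summable[OF s], of 0]) auto
  have "\<bar>\<Sum>j. a j\<bar> \<le> (\<Sum>j. \<bar>a j\<bar>)" by (rule summable_rabs[OF sa])
  also have "\<dots> \<le> (\<Sum>j. b * (1 / 2) ^ Suc j)" by (rule suminf_le[OF a sa sums_summable[OF s]])
  also have "\<dots> = b" using sums_unique[OF s] by simp
  finally have "cosh \<bar>\<Sum>j. a j\<bar> \<le> cosh b" using b(1) by (subst cosh_real_nonneg_le_iff) auto
  then show "cosh (\<Sum>j. a j) \<le> c" using b by simp
qed

text \<open>
  The common bound in \<open>cosh_suminf\<close> is replaced by a sum over \<open>j\<close>, which can be integrated term by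
  term.
\<close>

lemma cosh_suminf_ennreal:
  fixes a :: "nat \<Rightarrow> real"
  shows "(\<Sum>j. ennreal (cosh (2 ^ Suc j * a j) - 1)) \<noteq> \<infinity> \<Longrightarrow> summable (\<lambda>j. \<bar>a j\<bar>)"
    and "ennreal (cosh (\<Sum>j. a j) - 1) \<le> (\<Sum>j. ennreal (cosh (2 ^ Suc j * a j) - 1))"
proof -
  let ?S = "\<Sum>j. ennreal (cosh (2 ^ Suc j * a j) - 1)"
  have *: "cosh (2 ^ Suc j * a j) \<le> enn2real ?S + 1" if "?S \<noteq> \<infinity>" for j
  proof -
    have "ennreal (cosh (2 ^ Suc j * a j) - 1) \<le> ?S"
      using sum_le_suminf[of "\<lambda>j. ennreal (cosh (2 ^ Suc j * a j) - 1)" "{j}"] by simp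
    also have "?S = ennreal (enn2real ?S)" using that by (simp add: less_top)
    finally show ?thesis by (simp add: ennreal_le_iff)
  qed
  show "?S \<noteq> \<infinity> \<Longrightarrow> summable (\<lambda>j. \<bar>a j\<bar>)" using cosh_suminf(1) * by blast
  show "ennreal (cosh (\<Sum>j. a j) - 1) \<le> ?S"
  proof (cases "?S = \<infinity>")
    case False
    then have "ennreal (cosh (\<Sum>j. a j) - 1) \<le> ennreal (enn2real ?S)"
      using cosh_suminf(2)[OF *[OF False]] by (intro ennreal_leI) simp
    also have "\<dots> = ?S" using False by (simp add: less_top)
    finally show ?thesis .
  qed simp
qed

text \<open>
  The factor \<open>exp (p * ln p - p)\<close> is the maximum of \<open>\<bar>u\<bar> powr p * exp (- \<bar>u\<bar>)\<close>, attained at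
  \<open>\<bar>u\<bar> = p\<close>; the bound comes from \<open>ln s \<le> s - 1\<close> at \<open>s = \<bar>u\<bar> / p\<close>.
\<close>

lemma powr_le_cosh:
  fixes u p :: real
  assumes p: "p > 0"
  shows "\<bar>u\<bar> powr p \<le> 2 * exp (p * ln p - p) * cosh u"
proof (cases "u = 0")
  case False
  have "ln (\<bar>u\<bar> / p) \<le> \<bar>u\<bar> / p - 1" using p False by (intro ln_le_minus_one) auto
  then have "p * (ln \<bar>u\<bar> - ln p) \<le> p * (\<bar>u\<bar> / p - 1)"
    using p False by (intro mult_left_mono) (auto simp: ln_div)
  then have "p * ln \<bar>u\<bar> \<le> (p * ln p - p) + \<bar>u\<bar>" using p by (simp add: right_diff_distrib)
  then have "\<bar>u\<bar> powr p \<le> exp (p * ln p - p) * exp \<bar>u\<bar>"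
    using False by (simp add: powr_def flip: exp_add)
  also have "\<dots> \<le> exp (p * ln p - p) * (2 * cosh \<bar>u\<bar>)"
    by (intro mult_left_mono) (auto simp: cosh_field_def)
  finally show ?thesis by simp
qed (use p in simp)

lemma (in prob_space) cosh_integrable_Lp:
  assumes p: "p > 0" and f[measurable]: "f \<in> borel_measurable M"
    and fin: "(\<integral>\<^sup>+x. ennreal (cosh (f x)) \<partial>M) < \<infinity>"
  shows "f \<in> Lp_space M p"
proof -
  have "integrable M (\<lambda>x. cosh (f x))" using fin by (intro integrableI_nonneg) auto
  then have "integrable M (\<lambda>x. 2 * exp (p * ln p - p) * cosh (f x))" by simp
  then have "integrable M (\<lambda>x. \<bar>f x\<bar> powr p)"
    by (rule Bochner_Integration.integrable_bound) (use powr_le_cosh[OF p] in auto)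
  then show ?thesis by (simp add: Lp_space_def)
qed

section \<open>Linear operators modulo null sets\<close>

lemma linear_operator_measurable:
  "linear_operator M T \<Longrightarrow> f \<in> borel_measurable M \<Longrightarrow> T f \<in> borel_measurable M"
  by (simp add: linear_operator_def)

lemma linear_operator_add:
  "linear_operator M T \<Longrightarrow> f \<in> borel_measurable M \<Longrightarrow> g \<in> borel_measurable M \<Longrightarrow>
    AE x in M. T (\<lambda>y. f y + g y) x = T f x + T g x"
  by (simp add: linear_operator_def)

lemma linear_operator_scale:
  "linear_operator M T \<Longrightarrow> f \<in> borel_measurable M \<Longrightarrow> AE x in M. T (\<lambda>y. c * f y) x = c * T f x"
  by (simp add: linear_operator_def)

lemma linear_operator_diff:
  assumes T: "linear_operator M T" and [measurable]: "f \<in> borel_measurable M" "g \<in> borel_measurable M"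
  shows "AE x in M. T (\<lambda>y. f y - g y) x = T f x - T g x"
proof -
  have "AE x in M. T (\<lambda>y. f y + (- 1) * g y) x = T f x + T (\<lambda>y. (- 1) * g y) x"
    by (rule linear_operator_add[OF T]) measurable
  moreover have "AE x in M. T (\<lambda>y. (- 1) * g y) x = (- 1) * T g x"
    by (rule linear_operator_scale[OF T]) measurable
  ultimately show ?thesis by eventually_elim simp
qed

lemma linear_operator_sum:
  assumes T: "linear_operator M T" and "finite I" and "\<And>i. i \<in> I \<Longrightarrow> f i \<in> borel_measurable M"
  shows "AE x in M. T (\<lambda>y. \<Sum>i\<in>I. c i * f i y) x = (\<Sum>i\<in>I. c i * T (f i) x)"
  using assms(2,3)
proof (induction I)
  case empty
  show ?case using linear_operator_scale[OF T, of "\<lambda>_. 0" 0] by simp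
next
  case (insert i I)
  note [measurable] = insert.prems
  have "AE x in M. T (\<lambda>y. c i * f i y + (\<Sum>i\<in>I. c i * f i y)) x
      = T (\<lambda>y. c i * f i y) x + T (\<lambda>y. \<Sum>i\<in>I. c i * f i y) x"
    by (rule linear_operator_add[OF T]) measurable
  moreover have "AE x in M. T (\<lambda>y. c i * f i y) x = c i * T (f i) x"
    by (rule linear_operator_scale[OF T]) measurable
  moreover have "AE x in M. T (\<lambda>y. \<Sum>i\<in>I. c i * f i y) x = (\<Sum>i\<in>I. c i * T (f i) x)"
    using insert by simp
  ultimately have "AE x in M. T (\<lambda>y. c i * f i y + (\<Sum>i\<in>I. c i * f i y)) x
      = c i * T (f i) x + (\<Sum>i\<in>I. c i * T (f i) x)"
    by eventually_elim simp
  then show ?case using insert.hyps by simp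
qed

lemma integrable_square_diff:
  fixes f g :: "'a \<Rightarrow> real"
  assumes [measurable]: "f \<in> borel_measurable M" "g \<in> borel_measurable M"
    and int: "integrable M (\<lambda>x. (f x)\<^sup>2)" "integrable M (\<lambda>x. (g x)\<^sup>2)"
  shows "integrable M (\<lambda>x. (f x - g x)\<^sup>2)"
proof (rule Bochner_Integration.integrable_bound)
  show "integrable M (\<lambda>x. 2 * (f x)\<^sup>2 + 2 * (g x)\<^sup>2)" using int by auto
  show "AE x in M. norm ((f x - g x)\<^sup>2) \<le> norm (2 * (f x)\<^sup>2 + 2 * (g x)\<^sup>2)"
  proof (rule AE_I2)
    fix x
    have "(f x - g x)\<^sup>2 \<le> 2 * (f x)\<^sup>2 + 2 * (g x)\<^sup>2"
      using zero_le_power2[of "f x + g x"] by (simp add: power2_diff power2_sum)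
    then show "norm ((f x - g x)\<^sup>2) \<le> norm (2 * (f x)\<^sup>2 + 2 * (g x)\<^sup>2)" by simp
  qed
qed measurable

lemma Lp_space_2: "Lp_space M 2 = {f \<in> borel_measurable M. integrable M (\<lambda>x. (f x)\<^sup>2)}"
  by (simp add: Lp_space_def powr_numeral)

lemma Lp_norm_2: "Lp_norm M 2 f = sqrt (\<integral>x. (f x)\<^sup>2 \<partial>M)"
  by (simp add: Lp_norm_def powr_half_sqrt powr_numeral)

lemma bounded_on_L2_square:
  fixes M :: "'a measure"
  assumes "bounded_on_Lp M 2 T"
  obtains K where "K \<ge> 0"
    and "\<And>h :: 'a \<Rightarrow> real. h \<in> borel_measurable M \<Longrightarrow> integrable M (\<lambda>x. (h x)\<^sup>2) \<Longrightarrow>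
        integrable M (\<lambda>x. (T h x)\<^sup>2) \<and> (\<integral>x. (T h x)\<^sup>2 \<partial>M) \<le> K * (\<integral>x. (h x)\<^sup>2 \<partial>M)"
proof -
  from assms obtain L where L: "\<forall>f \<in> Lp_space M 2. Lp_norm M 2 (T f) \<le> L * Lp_norm M 2 f"
    unfolding bounded_on_Lp_def by blast
  show thesis
  proof (rule that[of "L\<^sup>2"])
    fix h :: "'a \<Rightarrow> real" assume h: "h \<in> borel_measurable M" "integrable M (\<lambda>x. (h x)\<^sup>2)"
    then have h2: "h \<in> Lp_space M 2" by (simp add: Lp_space_2)
    have nn: "0 \<le> (\<integral>x. (g x)\<^sup>2 \<partial>M)" for g :: "'a \<Rightarrow> real" by (intro integral_nonneg_AE) auto
    have "sqrt (\<integral>x. (T h x)\<^sup>2 \<partial>M) \<le> L * sqrt (\<integral>x. (h x)\<^sup>2 \<partial>M)"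
      using L h2 by (simp add: Lp_norm_2)
    then have "(sqrt (\<integral>x. (T h x)\<^sup>2 \<partial>M))\<^sup>2 \<le> (L * sqrt (\<integral>x. (h x)\<^sup>2 \<partial>M))\<^sup>2"
      by (rule power_mono) (simp add: nn)
    then show "integrable M (\<lambda>x. (T h x)\<^sup>2) \<and> (\<integral>x. (T h x)\<^sup>2 \<partial>M) \<le> L\<^sup>2 * (\<integral>x. (h x)\<^sup>2 \<partial>M)"
      using assms h2 nn unfolding bounded_on_Lp_def by (simp add: Lp_space_2 power_mult_distrib)
  qed simp
qed

lemma (in prob_space) markov_square:
  assumes [measurable]: "f \<in> borel_measurable M" and "integrable M (\<lambda>x. (f x)\<^sup>2)"
  shows "prob {x \<in> space M. 1 < \<bar>f x\<bar>} \<le> (\<integral>x. (f x)\<^sup>2 \<partial>M)"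
proof -
  have "prob {x \<in> space M. 1 < \<bar>f x\<bar>} \<le> prob {x \<in> space M. 1 \<le> (f x)\<^sup>2}"
    using abs_square_less_1[of "f _"] by (intro finite_measure_mono) (auto simp: not_less[symmetric])
  also have "\<dots> \<le> (\<integral>x. (f x)\<^sup>2 \<partial>M) / 1"
    using assms by (intro integral_Markov_inequality_measure[where A = "{}"]) auto
  finally show ?thesis by simp
qed

section \<open>Translates of the Gaussian measure\<close>

definition gauss :: "'i set \<Rightarrow> ('i \<Rightarrow> real) measure" where
  "gauss I = PiM I (\<lambda>_. density lborel std_normal_density)"

text \<open>
  Points of a product space are extensional functions, so that the sum of two points has to be
  restricted to the index set.
\<close>

definition translate :: "'i set \<Rightarrow> ('i \<Rightarrow> real) \<Rightarrow> ('i \<Rightarrow> real) \<Rightarrow> 'i \<Rightarrow> real" where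
  "translate I x g = (\<lambda>i\<in>I. g i + x i)"

lemma sets_gauss [measurable_cong]: "sets (gauss I) = sets (PiM I (\<lambda>_. borel))"
  unfolding gauss_def by (intro sets_PiM_cong) auto

lemma space_gauss: "space (gauss I) = I \<rightarrow>\<^sub>E UNIV"
  unfolding gauss_def by (simp add: space_PiM)

lemma prob_space_gauss: "prob_space (gauss I)"
  unfolding gauss_def by (intro prob_space_PiM prob_space_normal_density) auto

lemma translate_measurable [measurable]: "translate I x \<in> measurable (gauss I) (gauss I)"
  unfolding translate_def by measurable

text \<open>
  Completing the square: \<open>(t - a)\<^sup>2 = t\<^sup>2 - 2 * a * t + a\<^sup>2\<close>.
\<close>

lemma normal_translate:
  fixes u :: "real \<Rightarrow> ennreal"
  assumes [measurable]: "u \<in> borel_measurable borel"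
  shows "(\<integral>\<^sup>+t. u (t + a) \<partial>density lborel std_normal_density)
       = (\<integral>\<^sup>+t. u t * ennreal (exp (a * t - a\<^sup>2 / 2)) \<partial>density lborel std_normal_density)"
proof -
  have "(\<integral>\<^sup>+t. u (t + a) \<partial>density lborel std_normal_density)
      = (\<integral>\<^sup>+t. ennreal (std_normal_density t) * u (t + a) \<partial>lborel)"
    by (simp add: nn_integral_density)
  also have "\<dots> = (\<integral>\<^sup>+t. ennreal (std_normal_density (- a + 1 * t)) * u ((- a + 1 * t) + a) \<partial>lborel)"
    by (subst nn_integral_real_affine[where c = 1 and t = "- a"]) simp_all
  also have "\<dots> = (\<integral>\<^sup>+t. ennreal (std_normal_density t) * (u t * ennreal (exp (a * t - a\<^sup>2 / 2))) \<partial>lborel)"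
  proof (intro nn_integral_cong)
    fix t :: real
    have "std_normal_density (- a + t) = std_normal_density t * exp (a * t - a\<^sup>2 / 2)"
      by (simp add: std_normal_density_def flip: exp_add)
         (simp add: power2_eq_square field_simps)
    then show "ennreal (std_normal_density (- a + 1 * t)) * u ((- a + 1 * t) + a)
      = ennreal (std_normal_density t) * (u t * ennreal (exp (a * t - a\<^sup>2 / 2)))"
      by (simp add: ennreal_mult mult_ac)
  qed
  also have "\<dots> = (\<integral>\<^sup>+t. u t * ennreal (exp (a * t - a\<^sup>2 / 2)) \<partial>density lborel std_normal_density)"
    by (simp add: nn_integral_density)
  finally show ?thesis .
qed

text \<open>
  The Cameron--Martin formula in finite dimension. Both sides are product measures whose factors
  agree by the one-dimensional formula \<open>normal_translate\<close>.
\<close>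

lemma cameron_martin:
  assumes I: "finite I"
  shows "distr (gauss I) (gauss I) (translate I x)
    = density (gauss I) (\<lambda>g. ennreal (exp ((\<Sum>i\<in>I. x i * g i) - (\<Sum>i\<in>I. (x i)\<^sup>2) / 2)))" (is "?D = ?E")
proof -
  let ?N = "\<lambda>a. density (density lborel std_normal_density) (\<lambda>t. ennreal (exp (a * t - a\<^sup>2 / 2)))"
  let ?n = "density lborel std_normal_density"
  have N1: "?N a = distr ?n borel (\<lambda>t. t + a)" for a
  proof (rule measure_eqI)
    fix A assume "A \<in> sets (?N a)"
    then have [measurable]: "A \<in> sets borel" by simp
    have "emeasure (distr ?n borel (\<lambda>t. t + a)) A = (\<integral>\<^sup>+t. indicator A (t + a) \<partial>?n)"
      by (simp add: nn_integral_distr flip: nn_integral_indicator)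
    also have "\<dots> = (\<integral>\<^sup>+t. ennreal (exp (a * t - a\<^sup>2 / 2)) * indicator A t \<partial>?n)"
      by (subst normal_translate) (auto simp: mult_ac)
    finally show "emeasure (?N a) A = emeasure (distr ?n borel (\<lambda>t. t + a)) A"
      by (subst emeasure_density) auto
  qed simp
  have pN: "prob_space (?N a)" for a
    unfolding N1 by (rule prob_space.prob_space_distr) (auto intro: prob_space_normal_density)
  interpret P: product_sigma_finite "\<lambda>i. ?N (x i)"
    using pN by (auto simp: product_sigma_finite_def prob_space_imp_sigma_finite)
  interpret Q: product_sigma_finite "\<lambda>i. ?n"
    using prob_space_normal_density[of 1 0] by (auto simp: product_sigma_finite_def prob_space_imp_sigma_finite)
  have "?D = PiM I (\<lambda>i. ?N (x i))"
  proof (rule P.PiM_eqI[OF I])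
    show "sets ?D = sets (PiM I (\<lambda>i. ?N (x i)))"
      by (simp add: sets_gauss cong: sets_PiM_cong)
    fix A assume A: "\<And>i. i \<in> I \<Longrightarrow> A i \<in> sets (?N (x i))"
    then have A'[measurable]: "\<And>i. i \<in> I \<Longrightarrow> A i \<in> sets borel" by simp
    have m: "Pi\<^sub>E I A \<in> sets (gauss I)" unfolding sets_gauss using A' I by (intro sets_PiM_I_finite) auto
    have "emeasure ?D (Pi\<^sub>E I A) = emeasure (gauss I) (translate I x -` Pi\<^sub>E I A \<inter> space (gauss I))"
      using m by (rule emeasure_distr[OF translate_measurable])
    also have "translate I x -` Pi\<^sub>E I A \<inter> space (gauss I) = Pi\<^sub>E I (\<lambda>i. (\<lambda>t. t + x i) -` A i)"
      unfolding space_gauss translate_def by (auto simp: PiE_iff)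
    also have "emeasure (gauss I) \<dots> = (\<Prod>i\<in>I. emeasure ?n ((\<lambda>t. t + x i) -` A i))"
      unfolding gauss_def
    proof (rule Q.emeasure_PiM[OF I])
      fix i assume "i \<in> I"
      have "(\<lambda>t. t + x i) -` A i \<inter> space borel \<in> sets borel"
        using A'[OF \<open>i \<in> I\<close>] by measurable
      then show "(\<lambda>t. t + x i) -` A i \<in> sets ?n" by simp
    qed
    also have "\<dots> = (\<Prod>i\<in>I. emeasure (?N (x i)) (A i))"
      using A' unfolding N1 by (intro prod.cong) (auto simp: emeasure_distr)
    finally show "emeasure ?D (Pi\<^sub>E I A) = (\<Prod>i\<in>I. emeasure (?N (x i)) (A i))" .
  qed
  moreover have "?E = PiM I (\<lambda>i. ?N (x i))"
  proof (rule P.PiM_eqI[OF I])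
    show "sets ?E = sets (PiM I (\<lambda>i. ?N (x i)))"
      by (simp add: sets_gauss cong: sets_PiM_cong)
    fix A assume A: "\<And>i. i \<in> I \<Longrightarrow> A i \<in> sets (?N (x i))"
    then have A'[measurable]: "\<And>i. i \<in> I \<Longrightarrow> A i \<in> sets borel" by simp
    have m: "Pi\<^sub>E I A \<in> sets (gauss I)" unfolding sets_gauss using A' I by (intro sets_PiM_I_finite) auto
    have "emeasure ?E (Pi\<^sub>E I A)
      = (\<integral>\<^sup>+g. ennreal (exp ((\<Sum>i\<in>I. x i * g i) - (\<Sum>i\<in>I. (x i)\<^sup>2) / 2)) * indicator (Pi\<^sub>E I A) g \<partial>gauss I)"
      using m by (intro emeasure_density) simp_all
    also have "\<dots> = (\<integral>\<^sup>+g. (\<Prod>i\<in>I. ennreal (exp (x i * g i - (x i)\<^sup>2 / 2)) * indicator (A i) (g i)) \<partial>gauss I)"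
    proof (intro nn_integral_cong)
      fix g assume "g \<in> space (gauss I)"
      then have g: "indicator (Pi\<^sub>E I A) g = (\<Prod>i\<in>I. indicator (A i) (g i) :: ennreal)"
        using I by (auto simp: space_gauss indicator_def PiE_iff prod_zero_iff)
      have "(\<Sum>i\<in>I. x i * g i) - (\<Sum>i\<in>I. (x i)\<^sup>2) / 2 = (\<Sum>i\<in>I. x i * g i - (x i)\<^sup>2 / 2)"
        by (simp add: sum_subtractf sum_divide_distrib)
      then show "ennreal (exp ((\<Sum>i\<in>I. x i * g i) - (\<Sum>i\<in>I. (x i)\<^sup>2) / 2)) * indicator (Pi\<^sub>E I A) g
        = (\<Prod>i\<in>I. ennreal (exp (x i * g i - (x i)\<^sup>2 / 2)) * indicator (A i) (g i))"
        using I unfolding g by (simp add: prod.distrib exp_sum prod_ennreal)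
    qed
    also have "\<dots> = (\<Prod>i\<in>I. (\<integral>\<^sup>+t. ennreal (exp (x i * t - (x i)\<^sup>2 / 2)) * indicator (A i) t \<partial>?n))"
      unfolding gauss_def by (intro Q.product_nn_integral_prod I) (use A' in measurable)
    also have "\<dots> = (\<Prod>i\<in>I. emeasure (?N (x i)) (A i))"
      using A' by (intro prod.cong refl emeasure_density[symmetric]) auto
    finally show "emeasure ?E (Pi\<^sub>E I A) = (\<Prod>i\<in>I. emeasure (?N (x i)) (A i))" .
  qed
  ultimately show ?thesis by simp
qed

text \<open>
  The total mass of the translated Gaussian measure is one; the Cameron--Martin density expresses
  this as the formula for the moment generating function.
\<close>

lemma gauss_mgf:
  assumes I: "finite I"
  shows "(\<integral>\<^sup>+g. ennreal (exp (\<Sum>i\<in>I. x i * g i)) \<partial>gauss I) = ennreal (exp ((\<Sum>i\<in>I. (x i)\<^sup>2) / 2))"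
proof -
  interpret prob_space "gauss I" by (rule prob_space_gauss)
  let ?q = "(\<Sum>i\<in>I. (x i)\<^sup>2) / 2"
  have m: "space (gauss I) \<in> sets (gauss I)" by simp
  have "1 = emeasure (distr (gauss I) (gauss I) (translate I x)) (space (gauss I))"
    using prob_space.emeasure_space_1[OF prob_space_distr[OF translate_measurable[of I x]]] by simp
  also have "\<dots> = (\<integral>\<^sup>+g. ennreal (exp ((\<Sum>i\<in>I. x i * g i) - ?q)) * indicator (space (gauss I)) g \<partial>gauss I)"
    unfolding cameron_martin[OF I] using m by (intro emeasure_density) measurable
  also have "\<dots> = (\<integral>\<^sup>+g. ennreal (exp (- ?q)) * ennreal (exp (\<Sum>i\<in>I. x i * g i)) \<partial>gauss I)"
    by (intro nn_integral_cong) (simp flip: ennreal_mult exp_add)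
  also have "\<dots> = ennreal (exp (- ?q)) * (\<integral>\<^sup>+g. ennreal (exp (\<Sum>i\<in>I. x i * g i)) \<partial>gauss I)"
    by (intro nn_integral_cmult) measurable
  finally have 1: "1 = ennreal (exp (- ?q)) * (\<integral>\<^sup>+g. ennreal (exp (\<Sum>i\<in>I. x i * g i)) \<partial>gauss I)" .
  have "ennreal (exp ?q) = (ennreal (exp ?q) * ennreal (exp (- ?q))) * (\<integral>\<^sup>+g. ennreal (exp (\<Sum>i\<in>I. x i * g i)) \<partial>gauss I)"
    using arg_cong[OF 1, of "\<lambda>z. ennreal (exp ?q) * z"] by (simp add: mult.assoc)
  also have "ennreal (exp ?q) * ennreal (exp (- ?q)) = 1"
    by (simp flip: ennreal_mult exp_add)
  finally show ?thesis by simp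
qed

lemma gauss_cosh:
  assumes I: "finite I"
  shows "(\<integral>\<^sup>+g. ennreal (cosh (\<Sum>i\<in>I. x i * g i)) \<partial>gauss I) = ennreal (exp ((\<Sum>i\<in>I. (x i)\<^sup>2) / 2))"
proof -
  let ?q = "(\<Sum>i\<in>I. (x i)\<^sup>2) / 2"
  have "(\<integral>\<^sup>+g. ennreal (cosh (\<Sum>i\<in>I. x i * g i)) \<partial>gauss I)
    = (\<integral>\<^sup>+g. ennreal (1/2) * (ennreal (exp (\<Sum>i\<in>I. x i * g i)) + ennreal (exp (\<Sum>i\<in>I. (- x i) * g i))) \<partial>gauss I)"
    by (intro nn_integral_cong)
       (simp add: cosh_field_def sum_negf del: ennreal_half flip: ennreal_mult ennreal_plus)
  also have "\<dots> = ennreal (1/2) * (ennreal (exp ?q) + ennreal (exp ?q))"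
    using gauss_mgf[OF I, of x] gauss_mgf[OF I, of "\<lambda>i. - x i"]
    by (simp add: nn_integral_cmult nn_integral_add sum_negf del: ennreal_half)
  also have "\<dots> = ennreal (exp ?q)"
    by (simp del: ennreal_half flip: ennreal_mult ennreal_plus)
  finally show ?thesis .
qed

text \<open>
  Translation by \<open>x\<close> costs a set \<open>K\<close> at most the factor \<open>exp (- \<parallel>x\<parallel>\<^sup>2 / 2)\<close>, on average over
  \<open>x\<close> and \<open>- x\<close>: the two densities add up to \<open>2 * cosh (x \<bullet> g) * exp (- \<parallel>x\<parallel>\<^sup>2 / 2)\<close>.
\<close>

lemma gauss_translate_pair:
  assumes I: "finite I" and K: "K \<in> sets (gauss I)"
  shows "2 * exp (- (\<Sum>i\<in>I. (x i)\<^sup>2) / 2) * measure (gauss I) K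
    \<le> measure (gauss I) (translate I x -` K \<inter> space (gauss I))
      + measure (gauss I) (translate I (\<lambda>i. - x i) -` K \<inter> space (gauss I))"
proof -
  interpret prob_space "gauss I" by (rule prob_space_gauss)
  let ?q = "(\<Sum>i\<in>I. (x i)\<^sup>2) / 2"
  have [measurable]: "K \<in> sets (PiM I (\<lambda>_. borel))" using K sets_gauss by blast
  have *: "emeasure (gauss I) (translate I y -` K \<inter> space (gauss I))
     = (\<integral>\<^sup>+g. ennreal (exp ((\<Sum>i\<in>I. y i * g i) - (\<Sum>i\<in>I. (y i)\<^sup>2) / 2)) * indicator K g \<partial>gauss I)" for y
  proof -
    have "emeasure (gauss I) (translate I y -` K \<inter> space (gauss I))
      = emeasure (distr (gauss I) (gauss I) (translate I y)) K"
      using K by (rule emeasure_distr[OF translate_measurable, symmetric])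
    also have "\<dots> = (\<integral>\<^sup>+g. ennreal (exp ((\<Sum>i\<in>I. y i * g i) - (\<Sum>i\<in>I. (y i)\<^sup>2) / 2)) * indicator K g \<partial>gauss I)"
      unfolding cameron_martin[OF I] using K by (intro emeasure_density) measurable
    finally show ?thesis .
  qed
  have "ennreal (2 * exp (- ?q)) * emeasure (gauss I) K = (\<integral>\<^sup>+g. ennreal (2 * exp (- ?q)) * indicator K g \<partial>gauss I)"
    using K by (simp add: nn_integral_cmult_indicator)
  also have "\<dots> \<le> (\<integral>\<^sup>+g. ennreal (exp ((\<Sum>i\<in>I. x i * g i) - ?q)) * indicator K g
      + ennreal (exp ((\<Sum>i\<in>I. - x i * g i) - ?q)) * indicator K g \<partial>gauss I)"
  proof (intro nn_integral_mono)
    fix g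
    have "2 * exp (- ?q) \<le> 2 * cosh (\<Sum>i\<in>I. x i * g i) * exp (- ?q)"
      using cosh_real_ge_1[of "\<Sum>i\<in>I. x i * g i"] by (simp add: mult_right_mono)
    also have "\<dots> = exp ((\<Sum>i\<in>I. x i * g i) - ?q) + exp ((\<Sum>i\<in>I. - x i * g i) - ?q)"
      by (simp add: cosh_field_def sum_negf algebra_simps flip: exp_add)
    finally show "ennreal (2 * exp (- ?q)) * indicator K g \<le> ennreal (exp ((\<Sum>i\<in>I. x i * g i) - ?q)) * indicator K g
      + ennreal (exp ((\<Sum>i\<in>I. - x i * g i) - ?q)) * indicator K g"
      by (auto simp: indicator_def simp flip: ennreal_plus intro!: ennreal_leI)
  qed
  also have "\<dots> = (\<integral>\<^sup>+g. ennreal (exp ((\<Sum>i\<in>I. x i * g i) - ?q)) * indicator K g \<partial>gauss I)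
      + (\<integral>\<^sup>+g. ennreal (exp ((\<Sum>i\<in>I. - x i * g i) - ?q)) * indicator K g \<partial>gauss I)"
    using K by (intro nn_integral_add) measurable
  also have "\<dots> = emeasure (gauss I) (translate I x -` K \<inter> space (gauss I))
      + emeasure (gauss I) (translate I (\<lambda>i. - x i) -` K \<inter> space (gauss I))"
    using *[of x] *[of "\<lambda>i. - x i"] by simp
  finally show ?thesis
    by (simp add: emeasure_eq_measure flip: ennreal_plus ennreal_mult)
qed

section \<open>Sudakov minoration\<close>

text \<open>
  The dual form of Sudakov's inequality: points of a Euclidean ball of radius \<open>\<rho>\<close> that are
  \<open>r\<close>-separated in the seminorm \<open>\<parallel>y\<parallel> = max\<^sub>n \<bar>a n \<bullet> y\<bar>\<close> are few. Scale them by \<open>c = 2 * M / r\<close>. Then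
  the translates of \<open>K = {g. \<parallel>g\<parallel> < M}\<close> by the scaled points are disjoint, while
  \<open>gauss_translate_pair\<close> says that each of them still has, up to averaging with the opposite
  translate, measure at least \<open>3 / 4 * exp (- (c * \<rho>)\<^sup>2 / 2)\<close>.
\<close>

lemma gauss_packing:
  fixes a :: "'k \<Rightarrow> 'i \<Rightarrow> real" and x :: "'l \<Rightarrow> 'i \<Rightarrow> real"
  defines "K \<equiv> \<lambda>I A M. {g \<in> space (gauss I). \<forall>n\<in>A. \<bar>\<Sum>i\<in>I. a n i * g i\<bar> < M}"
  assumes I: "finite I" and A: "finite A" and P: "finite P" and r: "r > 0"
    and K: "measure (gauss I) (K I A M) \<ge> 3 / 4"
    and \<rho>: "\<And>p. p \<in> P \<Longrightarrow> (\<Sum>i\<in>I. (x p i)\<^sup>2) \<le> \<rho>\<^sup>2"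
    and sep: "\<And>p q. p \<in> P \<Longrightarrow> q \<in> P \<Longrightarrow> p \<noteq> q \<Longrightarrow> \<exists>n\<in>A. \<bar>\<Sum>i\<in>I. a n i * (x p i - x q i)\<bar> \<ge> r"
  shows "real (card P) \<le> exp (4 * \<rho>\<^sup>2 * M\<^sup>2 / r\<^sup>2)"
proof -
  interpret prob_space "gauss I" by (rule prob_space_gauss)
  \<comment> \<open>At this scale separation \<open>r\<close> becomes \<open>2 * M\<close>, the width of the slabs that bound \<open>K\<close>.\<close>
  define c where "c = 2 * M / r"
  define s where "s = exp (2 * \<rho>\<^sup>2 * M\<^sup>2 / r\<^sup>2)"
  have s2: "s * s = exp (4 * \<rho>\<^sup>2 * M\<^sup>2 / r\<^sup>2)" by (simp add: s_def flip: exp_add)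
  have s1: "s \<ge> 1" by (simp add: s_def)
  have Km: "K I A M \<in> sets (gauss I)" unfolding K_def using A by measurable
  define U where "U = (\<lambda>t p. translate I (\<lambda>i. t * c * x p i) -` K I A M \<inter> space (gauss I))"
  have Um: "U t p \<in> events" for t p
    unfolding U_def using Km by (rule measurable_sets[OF translate_measurable])
  have disj: "disjoint_family_on (U t) P" if t: "t = 1 \<or> t = - 1" for t
    unfolding disjoint_family_on_def
  proof (intro ballI impI)
    fix p q assume pq: "p \<in> P" "q \<in> P" "p \<noteq> q"
    from sep[OF pq] obtain n where n: "n \<in> A" "\<bar>\<Sum>i\<in>I. a n i * (x p i - x q i)\<bar> \<ge> r" by blast
    show "U t p \<inter> U t q = {}"
    proof (rule ccontr)
      assume "U t p \<inter> U t q \<noteq> {}"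
      then obtain g where g: "g \<in> U t p" "g \<in> U t q" by blast
      have *: "\<bar>(\<Sum>i\<in>I. a n i * g i) + t * c * (\<Sum>i\<in>I. a n i * x p i)\<bar> < M" if "g \<in> U t p" for p
      proof -
        have "\<bar>\<Sum>i\<in>I. a n i * (g i + t * c * x p i)\<bar> < M"
          using that n(1) unfolding U_def K_def by (auto simp: translate_def)
        moreover have "(\<Sum>i\<in>I. a n i * (g i + t * c * x p i))
          = (\<Sum>i\<in>I. a n i * g i) + t * c * (\<Sum>i\<in>I. a n i * x p i)"
          unfolding sum_distrib_left sum.distrib[symmetric]
          by (intro sum.cong) (auto simp: algebra_simps)
        ultimately show ?thesis by simp
      qed
      have "\<bar>t * c * (\<Sum>i\<in>I. a n i * (x p i - x q i))\<bar> < 2 * M"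
        using *[OF g(1)] *[OF g(2)] by (simp add: right_diff_distrib sum_subtractf)
      then have 1: "\<bar>c\<bar> * \<bar>\<Sum>i\<in>I. a n i * (x p i - x q i)\<bar> < 2 * M"
        using t by (auto simp: abs_mult)
      have "\<bar>c\<bar> * r \<le> \<bar>c\<bar> * \<bar>\<Sum>i\<in>I. a n i * (x p i - x q i)\<bar>"
        using n(2) by (intro mult_left_mono) auto
      also note 1
      finally show False using r by (simp add: c_def abs_mult)
    qed
  qed
  have le1: "(\<Sum>p\<in>P. prob (U t p)) \<le> 1" if "t = 1 \<or> t = - 1" for t
  proof -
    have "(\<Sum>p\<in>P. prob (U t p)) = prob (\<Union>p\<in>P. U t p)"
      using Um by (intro finite_measure_finite_Union[symmetric] P disj that) auto
    then show ?thesis by simp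
  qed
  have ge: "3 / (2 * s) \<le> prob (U 1 p) + prob (U (-1) p)" if "p \<in> P" for p
  proof -
    have "(\<Sum>i\<in>I. (c * x p i)\<^sup>2) / 2 \<le> 2 * \<rho>\<^sup>2 * M\<^sup>2 / r\<^sup>2"
      using mult_left_mono[OF \<rho>[OF that], of "c\<^sup>2 / 2"]
      unfolding power_mult_distrib sum_distrib_left[symmetric]
      by (simp add: c_def power_mult_distrib power_divide mult_ac)
    moreover have "1 / s = exp (- (2 * \<rho>\<^sup>2 * M\<^sup>2 / r\<^sup>2))"
      unfolding s_def by (simp only: exp_minus inverse_eq_divide)
    ultimately have "1 / s \<le> exp (- (\<Sum>i\<in>I. (c * x p i)\<^sup>2) / 2)" by simp
    then have "2 * (1 / s) * (3 / 4) \<le> 2 * exp (- (\<Sum>i\<in>I. (c * x p i)\<^sup>2) / 2) * prob (K I A M)"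
      using K s1 by (intro mult_mono) auto
    also have "\<dots> \<le> prob (U 1 p) + prob (U (-1) p)"
      using gauss_translate_pair[OF I Km, of "\<lambda>i. c * x p i"] by (simp add: U_def)
    finally show ?thesis by (simp add: field_simps)
  qed
  have "real (card P) * (3 / (2 * s)) \<le> (\<Sum>p\<in>P. prob (U 1 p) + prob (U (-1) p))"
    using sum_mono[OF ge, of P] by simp
  also have "\<dots> \<le> 2" using le1[of 1] le1[of "-1"] by (simp add: sum.distrib)
  finally have n: "real (card P) \<le> 4 / 3 * s" using s1 by (simp add: field_simps)
  show ?thesis
  proof (cases "card P \<le> 1")
    case True
    have "1 \<le> s * s" using s1 by (simp add: mult_ge1_I)
    then show ?thesis using True s2 by linarith
  next
    case False
    \<comment> \<open>With two points the constant \<open>4 / 3\<close> is itself at most \<open>s\<close> and can be absorbed.\<close>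
    then have "4 / 3 \<le> s" using n by linarith
    then have "4 / 3 * s \<le> s * s" using s1 by (intro mult_right_mono) auto
    then show ?thesis using n s2 by linarith
  qed
qed

text \<open>
  An \<open>\<epsilon>\<close>-separated set \<open>Q\<close> is compared with a maximal \<open>2 * \<epsilon>\<close>-separated subset \<open>R\<close>. Every point of
  \<open>Q\<close> lies in a Euclidean ball of radius \<open>2 * \<epsilon>\<close> around a point of \<open>R\<close>. Two points \<open>p\<close>, \<open>q\<close> of the
  same ball satisfy
  \<open>\<epsilon>\<^sup>2 \<le> \<parallel>a p - a q\<parallel>\<^sup>2 = a p \<bullet> (a p - a q) - a q \<bullet> (a p - a q)\<close>, so that they are
  \<open>\<epsilon>\<^sup>2 / 2\<close>-separated in the seminorm of \<open>gauss_packing\<close>, and each ball contains at most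
  \<open>exp (64 * M\<^sup>2 / \<epsilon>\<^sup>2)\<close> of them. The exponents at the scales \<open>\<epsilon>, 2 * \<epsilon>, 4 * \<epsilon>, \<dots>\<close> form a geometric
  series with ratio \<open>1 / 4\<close> and sum \<open>256 / 3 * M\<^sup>2 / \<epsilon>\<^sup>2\<close>. The number \<open>k\<close> counts the scales below the
  diameter.
\<close>

lemma sudakov_scale:
  fixes a :: "'k \<Rightarrow> 'i \<Rightarrow> real"
  defines "D \<equiv> \<lambda>I p q. \<Sum>i\<in>I. (a p i - a q i)\<^sup>2"
  assumes I: "finite I" and A: "finite A"
    and K: "measure (gauss I) {g \<in> space (gauss I). \<forall>n\<in>A. \<bar>\<Sum>i\<in>I. a n i * g i\<bar> < M} \<ge> 3 / 4"
  assumes "\<epsilon> > 0" "Q \<subseteq> A" "Q \<noteq> {}"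
    and "\<And>p q. p \<in> Q \<Longrightarrow> q \<in> Q \<Longrightarrow> p \<noteq> q \<Longrightarrow> \<epsilon>\<^sup>2 \<le> D I p q"
    and "\<And>p q. p \<in> Q \<Longrightarrow> q \<in> Q \<Longrightarrow> D I p q < (2 ^ k * \<epsilon>)\<^sup>2"
  shows "ln (real (card Q)) \<le> 256 / 3 * M\<^sup>2 / \<epsilon>\<^sup>2"
  using assms(5-)
proof (induction k arbitrary: \<epsilon> Q)
  case 0
  have fQ: "finite Q" using A 0 finite_subset by blast
  have "p = q" if "p \<in> Q" "q \<in> Q" for p q
    using 0(4)[OF that] 0(5)[OF that] by force
  then have "card Q \<le> 1" using fQ by (auto simp: card_le_Suc0_iff_eq)
  then have "card Q = 0 \<or> card Q = 1" by linarith
  then show ?case by auto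
next
  case (Suc k)
  note \<epsilon> = Suc.prems(1) and QA = Suc.prems(2) and sep = Suc.prems(4) and diam = Suc.prems(5)
  have fQ: "finite Q" using A QA finite_subset by blast
  define F where "F = {R. R \<subseteq> Q \<and> (\<forall>p\<in>R. \<forall>q\<in>R. p \<noteq> q \<longrightarrow> (2 * \<epsilon>)\<^sup>2 \<le> D I p q)}"
  have "finite F" unfolding F_def using fQ by (auto intro: finite_subset[of _ "Pow Q"])
  moreover have "{} \<in> F" by (auto simp: F_def)
  ultimately obtain R where R: "R \<in> F" and max: "\<And>R'. R' \<in> F \<Longrightarrow> R \<subseteq> R' \<Longrightarrow> R = R'"
    using finite_has_maximal2[of F "{}"] by auto
  have RQ: "R \<subseteq> Q" and Rsep: "\<And>p q. p \<in> R \<Longrightarrow> q \<in> R \<Longrightarrow> p \<noteq> q \<Longrightarrow> (2 * \<epsilon>)\<^sup>2 \<le> D I p q"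
    using R by (auto simp: F_def)
  have fR: "finite R" using RQ fQ finite_subset by blast
  have Dsym: "D I p q = D I q p" for p q
    unfolding D_def by (intro sum.cong refl) (simp add: power2_commute)
  have cover: "\<exists>q\<in>R. D I p q < (2 * \<epsilon>)\<^sup>2" if "p \<in> Q" for p
  proof (cases "p \<in> R")
    case True
    then show ?thesis using \<epsilon> by (auto simp: D_def intro!: bexI[of _ p])
  next
    case False
    then have "insert p R \<notin> F" using max[of "insert p R"] by auto
    show ?thesis
    proof (rule ccontr)
      assume "\<not> ?thesis"
      then have ge: "(2 * \<epsilon>)\<^sup>2 \<le> D I p q" if "q \<in> R" for q using that by (meson not_le)
      have "(2 * \<epsilon>)\<^sup>2 \<le> D I q p" if "q \<in> R" for q using ge[OF that] unfolding Dsym[of q p] .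
      then have "insert p R \<in> F" unfolding F_def using ge that RQ Rsep by blast
      with \<open>insert p R \<notin> F\<close> show False by blast
    qed
  qed
  have Rne: "R \<noteq> {}" using cover Suc.prems(3) by blast
  have "ln (real (card R)) \<le> 256 / 3 * M\<^sup>2 / (2 * \<epsilon>)\<^sup>2"
  proof (rule Suc.IH)
    have "2 ^ Suc k * \<epsilon> = 2 ^ k * (2 * \<epsilon>)" by simp
    then show "D I p q < (2 ^ k * (2 * \<epsilon>))\<^sup>2" if "p \<in> R" "q \<in> R" for p q
      using diam[of p q] that RQ by (metis subsetD)
    show "0 < 2 * \<epsilon>" "R \<subseteq> A" using \<epsilon> QA RQ by auto
  qed (fact Rne Rsep)+
  then have lnR: "ln (real (card R)) \<le> 64 / 3 * M\<^sup>2 / \<epsilon>\<^sup>2"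
    by (simp add: power_mult_distrib)
  define C where "C = (\<lambda>q. {p \<in> Q. D I p q < (2 * \<epsilon>)\<^sup>2})"
  have cell: "real (card (C q)) \<le> exp (64 * M\<^sup>2 / \<epsilon>\<^sup>2)" if q: "q \<in> R" for q
  proof -
    have "real (card (C q)) \<le> exp (4 * (2 * \<epsilon>)\<^sup>2 * M\<^sup>2 / (\<epsilon>\<^sup>2 / 2)\<^sup>2)"
    proof (rule gauss_packing[OF I A _ _ K, where x = "\<lambda>p i. a p i - a q i"])
      show "finite (C q)" using fQ by (simp add: C_def)
      show "0 < \<epsilon>\<^sup>2 / 2" using \<epsilon> by simp
      show "(\<Sum>i\<in>I. (a p i - a q i)\<^sup>2) \<le> (2 * \<epsilon>)\<^sup>2" if "p \<in> C q" for p
        using that by (simp add: C_def D_def)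
      fix p p' assume p: "p \<in> C q" "p' \<in> C q" "p \<noteq> p'"
      then have pQ: "p \<in> Q" "p' \<in> Q" by (auto simp: C_def)
      let ?s = "\<lambda>n. \<Sum>i\<in>I. a n i * ((a p i - a q i) - (a p' i - a q i))"
      have "D I p p' = ?s p - ?s p'"
        unfolding D_def sum_subtractf[symmetric] by (intro sum.cong) (auto simp: power2_eq_square algebra_simps)
      with sep[OF pQ p(3)] have "\<epsilon>\<^sup>2 / 2 \<le> \<bar>?s p\<bar> \<or> \<epsilon>\<^sup>2 / 2 \<le> \<bar>?s p'\<bar>" by linarith
      then show "\<exists>n\<in>A. \<epsilon>\<^sup>2 / 2 \<le> \<bar>?s n\<bar>" using pQ QA by blast
    qed
    also have "4 * (2 * \<epsilon>)\<^sup>2 * M\<^sup>2 / (\<epsilon>\<^sup>2 / 2)\<^sup>2 = 64 * M\<^sup>2 / \<epsilon>\<^sup>2"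
      using \<epsilon> by (simp add: power2_eq_square field_simps)
    finally show ?thesis .
  qed
  have "Q = (\<Union>q\<in>R. C q)" using cover by (auto simp: C_def)
  then have "card Q \<le> (\<Sum>q\<in>R. card (C q))" using card_UN_le[OF fR, of C] by simp
  then have "real (card Q) \<le> (\<Sum>q\<in>R. real (card (C q)))"
    by (metis of_nat_mono of_nat_sum)
  also have "\<dots> \<le> real (card R) * exp (64 * M\<^sup>2 / \<epsilon>\<^sup>2)"
    using sum_mono[OF cell, of R] by simp
  finally have le: "real (card Q) \<le> real (card R) * exp (64 * M\<^sup>2 / \<epsilon>\<^sup>2)" .
  have pos: "0 < real (card Q)" "0 < real (card R)"
    using fQ fR Rne Suc.prems(3) by (auto simp: card_gt_0_iff)
  have "ln (real (card Q)) \<le> ln (real (card R) * exp (64 * M\<^sup>2 / \<epsilon>\<^sup>2))"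
    using le pos by (subst ln_le_cancel_iff) auto
  also have "\<dots> = ln (real (card R)) + 64 * M\<^sup>2 / \<epsilon>\<^sup>2" using pos by (simp add: ln_mult)
  also have "\<dots> \<le> 64 / 3 * M\<^sup>2 / \<epsilon>\<^sup>2 + 64 * M\<^sup>2 / \<epsilon>\<^sup>2" using lnR by simp
  also have "\<dots> = 256 / 3 * M\<^sup>2 / \<epsilon>\<^sup>2" by (simp add: field_simps)
  finally show ?case .
qed

text \<open>
  Sudakov's inequality in a form that assumes a bound in probability for the process
  \<open>g \<mapsto> a n \<bullet> g\<close> instead of a bound for the expectation of its supremum.
\<close>

theorem sudakov_minoration:
  fixes a :: "'k \<Rightarrow> 'i \<Rightarrow> real"
  assumes I: "finite I" and A: "finite A" "A \<noteq> {}" and \<epsilon>: "\<epsilon> > 0"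
    and K: "measure (gauss I) {g \<in> space (gauss I). \<forall>n\<in>A. \<bar>\<Sum>i\<in>I. a n i * g i\<bar> < M} \<ge> 3 / 4"
    and sep: "\<And>p q. p \<in> A \<Longrightarrow> q \<in> A \<Longrightarrow> p \<noteq> q \<Longrightarrow> \<epsilon>\<^sup>2 \<le> (\<Sum>i\<in>I. (a p i - a q i)\<^sup>2)"
  shows "ln (real (card A)) \<le> 256 / 3 * M\<^sup>2 / \<epsilon>\<^sup>2"
proof -
  define D where "D = (\<lambda>p q. \<Sum>i\<in>I. (a p i - a q i)\<^sup>2)"
  define B where "B = (\<Sum>p\<in>A. \<Sum>q\<in>A. D p q)"
  have nn: "0 \<le> D p q" for p q unfolding D_def by (simp add: sum_nonneg)
  have DB: "D p q \<le> B" if "p \<in> A" "q \<in> A" for p q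
  proof -
    have "D p q \<le> (\<Sum>q\<in>A. D p q)" using that A nn by (intro member_le_sum) auto
    also have "\<dots> \<le> B" unfolding B_def
      using that A nn by (intro member_le_sum[where f = "\<lambda>p. \<Sum>q\<in>A. D p q"] sum_nonneg) auto
    finally show ?thesis .
  qed
  obtain k where k: "(B + 1) / \<epsilon>\<^sup>2 < 2 ^ k" using real_arch_pow[of 2] by auto
  have "D p q < (2 ^ k * \<epsilon>)\<^sup>2" if "p \<in> A" "q \<in> A" for p q
  proof -
    have "D p q < B + 1" using DB[OF that] by simp
    also have "\<dots> < 2 ^ k * \<epsilon>\<^sup>2" using k \<epsilon> by (simp add: field_simps)
    also have "\<dots> \<le> (2 ^ k * \<epsilon>)\<^sup>2"
      using mult_right_mono[of 1 "2 ^ k" "\<epsilon>\<^sup>2"]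
      by (simp add: power_mult_distrib power2_eq_square[of "2 ^ k"])
    finally show ?thesis .
  qed
  then show ?thesis
    using sudakov_scale[OF I A(1) K \<epsilon> subset_refl A(2), of k] sep by (simp add: D_def)
qed

section \<open>A Banach principle\<close>

lemma (in prob_space) exceed_in_finite_range:
  fixes u :: "nat \<Rightarrow> 'a \<Rightarrow> real"
  assumes [measurable]: "\<And>n. u n \<in> borel_measurable M"
    and "c < prob {x \<in> space M. \<exists>n. R < \<bar>u n x\<bar>}"
  obtains N where "c < prob {x \<in> space M. \<exists>n<N. R < \<bar>u n x\<bar>}"
proof -
  have "(\<lambda>N. prob {x \<in> space M. \<exists>n<N. R < \<bar>u n x\<bar>}) \<longlonglongrightarrow> prob (\<Union>N. {x \<in> space M. \<exists>n<N. R < \<bar>u n x\<bar>})"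
    by (rule finite_Lim_measure_incseq) (auto simp: incseq_def intro: less_le_trans)
  also have "(\<Union>N. {x \<in> space M. \<exists>n<N. R < \<bar>u n x\<bar>}) = {x \<in> space M. \<exists>n. R < \<bar>u n x\<bar>}"
    by auto
  finally have "\<forall>\<^sub>F N in sequentially. c < prob {x \<in> space M. \<exists>n<N. R < \<bar>u n x\<bar>}"
    using assms(2) by (rule order_tendstoD)
  then show thesis using that by (auto simp: eventually_sequentially)
qed

text \<open>
  Finitely many bounded operators on \<open>L\<^sup>2\<close> are simultaneously continuous at zero with respect to
  convergence in measure, by Chebyshev's inequality.
\<close>

lemma (in prob_space) small_input_small_output:
  assumes lin: "\<And>n. linear_operator M (S n)" and bdd: "\<And>n. bounded_on_Lp M 2 (S n)"
    and \<eta>: "0 < (\<eta>::real)"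
  obtains r where "0 < r"
    and "\<And>h. h \<in> borel_measurable M \<Longrightarrow> (\<integral>\<^sup>+x. ennreal ((h x)\<^sup>2) \<partial>M) \<le> ennreal r \<Longrightarrow>
      prob {x \<in> space M. \<exists>n<N::nat. 1 < \<bar>S n h x\<bar>} \<le> \<eta>"
proof -
  have "\<forall>n. \<exists>K\<ge>0. \<forall>h \<in> borel_measurable M. integrable M (\<lambda>x. (h x)\<^sup>2) \<longrightarrow>
      integrable M (\<lambda>x. (S n h x)\<^sup>2) \<and> (\<integral>x. (S n h x)\<^sup>2 \<partial>M) \<le> K * (\<integral>x. (h x)\<^sup>2 \<partial>M)"
    using bounded_on_L2_square[OF bdd] by metis
  then obtain K where K: "\<And>n. 0 \<le> K n" and
    K': "\<And>n h. h \<in> borel_measurable M \<Longrightarrow> integrable M (\<lambda>x. (h x)\<^sup>2) \<Longrightarrow>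
      integrable M (\<lambda>x. (S n h x)\<^sup>2) \<and> (\<integral>x. (S n h x)\<^sup>2 \<partial>M) \<le> K n * (\<integral>x. (h x)\<^sup>2 \<partial>M)"
    by metis
  define r where "r = \<eta> / ((\<Sum>n<N. K n) + 1)"
  have K0: "0 \<le> (\<Sum>n<N. K n)" using K by (simp add: sum_nonneg)
  have r: "0 < r" using \<eta> K0 by (simp add: r_def)
  show thesis
  proof (rule that[OF r])
    fix h :: "'a \<Rightarrow> real"
    assume h[measurable]: "h \<in> borel_measurable M" and hr: "(\<integral>\<^sup>+x. ennreal ((h x)\<^sup>2) \<partial>M) \<le> ennreal r"
    have int: "integrable M (\<lambda>x. (h x)\<^sup>2)"
      using hr by (intro integrableI_nonneg) (auto intro: le_less_trans)
    have le: "(\<integral>x. (h x)\<^sup>2 \<partial>M) \<le> r"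
      using hr r by (simp add: nn_integral_eq_integral[OF int] ennreal_le_iff)
    note [measurable] = linear_operator_measurable[OF lin]
    have "prob {x \<in> space M. \<exists>n<N. 1 < \<bar>S n h x\<bar>} \<le> prob (\<Union>n\<in>{..<N}. {x \<in> space M. 1 < \<bar>S n h x\<bar>})"
      by (intro finite_measure_mono) auto
    also have "\<dots> \<le> (\<Sum>n<N. prob {x \<in> space M. 1 < \<bar>S n h x\<bar>})"
      by (intro measure_UNION_le) auto
    also have "\<dots> \<le> (\<Sum>n<N. K n * r)"
    proof (rule sum_mono)
      fix n
      have "prob {x \<in> space M. 1 < \<bar>S n h x\<bar>} \<le> (\<integral>x. (S n h x)\<^sup>2 \<partial>M)"
        using K'[OF h int] by (intro markov_square) auto
      also have "\<dots> \<le> K n * (\<integral>x. (h x)\<^sup>2 \<partial>M)" using K'[OF h int] by simp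
      also have "\<dots> \<le> K n * r" using le K by (intro mult_left_mono) auto
      finally show "prob {x \<in> space M. 1 < \<bar>S n h x\<bar>} \<le> K n * r" .
    qed
    also have "\<dots> = (\<Sum>n<N. K n) * r" by (simp add: sum_distrib_right)
    also have "\<dots> \<le> \<eta>" using K0 \<eta> by (simp add: r_def field_simps)
    finally show "prob {x \<in> space M. \<exists>n<N. 1 < \<bar>S n h x\<bar>} \<le> \<eta>" .
  qed
qed

text \<open>
  A linear operator acts on representatives and may distinguish functions that agree almost
  everywhere; boundedness on \<open>L\<^sup>2\<close> excludes this for square integrable functions.
\<close>

lemma bounded_on_L2_AE_zero:
  assumes T: "bounded_on_Lp M 2 T" "linear_operator M T"
    and h[measurable]: "h \<in> borel_measurable M" and z: "AE x in M. h x = 0"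
  shows "AE x in M. T h x = 0"
proof -
  have int: "integrable M (\<lambda>x. (h x)\<^sup>2)" and 0: "(\<integral>x. (h x)\<^sup>2 \<partial>M) = 0"
    using z by (auto intro!: integrable_cong_AE_imp[OF integrable_zero] integral_eq_zero_AE)
  obtain K where "integrable M (\<lambda>x. (T h x)\<^sup>2) \<and> (\<integral>x. (T h x)\<^sup>2 \<partial>M) \<le> K * (\<integral>x. (h x)\<^sup>2 \<partial>M)"
    using bounded_on_L2_square[OF T(1)] h int by metis
  then have "integrable M (\<lambda>x. (T h x)\<^sup>2)" "(\<integral>x. (T h x)\<^sup>2 \<partial>M) \<le> 0" using 0 by auto
  moreover from this have "(\<integral>x. (T h x)\<^sup>2 \<partial>M) = 0"
    by (intro antisym integral_nonneg_AE) auto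
  ultimately show ?thesis
    by (subst (asm) integral_nonneg_eq_0_iff_AE) auto
qed

text \<open>
  If small functions can have a large maximal function, then so can some small perturbation \<open>g\<close> of
  any given \<open>f\<close>. Indeed \<open>S n (f + \<xi>) - S n (f - \<xi>) = 2 * S n \<xi>\<close>, so wherever \<open>S n \<xi>\<close> is large, it
  is large for \<open>f + \<xi>\<close> or for \<open>f - \<xi>\<close>, and one of the two signs takes at least half of the set.
\<close>

lemma (in prob_space) gliding_hump_step:
  assumes lin: "\<And>n. linear_operator M (S n)"
    and f[measurable]: "f \<in> borel_measurable M" and r: "0 < r" and C: "0 < C" and L: "1 \<le> L"
    and bad: "\<And>R. \<exists>h\<in>borel_measurable M. (\<integral>\<^sup>+x. ennreal (cosh (h x)) \<partial>M) \<le> ennreal C \<and>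
      \<epsilon> < prob {x \<in> space M. \<exists>n. R < \<bar>S n h x\<bar>}"
  obtains g N where "g \<in> borel_measurable M"
    and "(\<integral>\<^sup>+x. ennreal (cosh (L * (g x - f x)) - 1) \<partial>M) \<le> ennreal r"
    and "\<epsilon> / 2 < prob {x \<in> space M. \<exists>n<N::nat. R < \<bar>S n g x\<bar>}"
proof -
  note [measurable] = linear_operator_measurable[OF lin]
  \<comment> \<open>By convexity the bound \<open>C\<close> for \<open>\<integral> cosh h\<close> becomes the bound \<open>L / l * C \<le> r\<close> for
    \<open>\<integral> (cosh (L * h / l) - 1)\<close>.\<close>
  define l where "l = L * max 1 (C / r)"
  have lL: "L \<le> l" and l0: "0 < l" using L by (auto simp: l_def mult_le_cancel_left1)
  have "L / l * C = C / max 1 (C / r)" using L by (simp add: l_def)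
  also have "\<dots> \<le> r" using r C by (simp add: max_def field_simps)
  finally have lC: "L / l * C \<le> r" .
  obtain h where h[measurable]: "h \<in> borel_measurable M"
    and hC: "(\<integral>\<^sup>+x. ennreal (cosh (h x)) \<partial>M) \<le> ennreal C"
    and hR: "\<epsilon> < prob {x \<in> space M. \<exists>n. l * R < \<bar>S n h x\<bar>}"
    using bad[of "l * R"] by blast
  obtain N where N: "\<epsilon> < prob {x \<in> space M. \<exists>n<N. l * R < \<bar>S n h x\<bar>}"
    by (rule exceed_in_finite_range[OF _ hR]) measurable
  define g where "g = (\<lambda>s x. f x + s / l * h x)"
  have g[measurable]: "g s \<in> borel_measurable M" for s unfolding g_def by measurable
  have close: "(\<integral>\<^sup>+x. ennreal (cosh (L * (g s x - f x)) - 1) \<partial>M) \<le> ennreal r" if s: "s = 1 \<or> s = -1" for s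
  proof -
    have "(\<integral>\<^sup>+x. ennreal (cosh (L * (g s x - f x)) - 1) \<partial>M) \<le> (\<integral>\<^sup>+x. ennreal (L / l) * ennreal (cosh (h x)) \<partial>M)"
    proof (rule nn_integral_mono)
      fix x
      have "cosh (L * (g s x - f x)) = cosh (L / l * h x)"
        using s by (auto simp: g_def)
      also have "\<dots> - 1 \<le> L / l * (cosh (h x) - 1)" using L lL l0 by (intro cosh_scale) auto
      also have "\<dots> \<le> L / l * cosh (h x)" using L l0 by (intro mult_left_mono) auto
      finally show "ennreal (cosh (L * (g s x - f x)) - 1) \<le> ennreal (L / l) * ennreal (cosh (h x))"
        using L l0 by (simp add: ennreal_leI flip: ennreal_mult)
    qed
    also have "\<dots> = ennreal (L / l) * (\<integral>\<^sup>+x. ennreal (cosh (h x)) \<partial>M)"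
      by (rule nn_integral_cmult) measurable
    also have "\<dots> \<le> ennreal (L / l) * ennreal C" using hC by (rule mult_left_mono) simp
    also have "\<dots> \<le> ennreal r" using lC L l0 C by (simp add: ennreal_leI flip: ennreal_mult)
    finally show ?thesis .
  qed
  define E where "E = (\<lambda>s. {x \<in> space M. \<exists>n<N. R < \<bar>S n (g s) x\<bar>})"
  have Em[measurable]: "E s \<in> events" for s unfolding E_def by measurable
  have diff: "(\<lambda>y. g 1 y - g (-1) y) = (\<lambda>y. 2 / l * h y)"
    using l0 by (auto simp: g_def field_simps)
  have "AE x in M. \<forall>n. S n (\<lambda>y. g 1 y - g (-1) y) x = S n (g 1) x - S n (g (-1)) x"
    unfolding AE_all_countable by (intro allI linear_operator_diff[OF lin]) measurable
  moreover have "AE x in M. \<forall>n. S n (\<lambda>y. 2 / l * h y) x = 2 / l * S n h x"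
    unfolding AE_all_countable by (intro allI linear_operator_scale[OF lin]) measurable
  ultimately have ae: "AE x in M. \<forall>n. 2 / l * S n h x = S n (g 1) x - S n (g (-1)) x"
    unfolding diff by eventually_elim simp
  have "prob {x \<in> space M. \<exists>n<N. l * R < \<bar>S n h x\<bar>} \<le> prob (E 1 \<union> E (-1))"
  proof (rule finite_measure_mono_AE)
    show "AE x in M. x \<in> {x \<in> space M. \<exists>n<N. l * R < \<bar>S n h x\<bar>} \<longrightarrow> x \<in> E 1 \<union> E (- 1)"
      using ae
    proof (rule AE_mp, intro AE_I2 impI)
      fix x assume x: "x \<in> space M" and eq: "\<forall>n. 2 / l * S n h x = S n (g 1) x - S n (g (-1)) x"
        and "x \<in> {x \<in> space M. \<exists>n<N. l * R < \<bar>S n h x\<bar>}"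
      then obtain n where n: "n < N" "l * R < \<bar>S n h x\<bar>" by blast
      have "2 / l * (l * R) < 2 / l * \<bar>S n h x\<bar>" using n(2) l0 by (intro mult_strict_left_mono) auto
      also have "\<dots> = \<bar>2 / l * S n h x\<bar>" using l0 by (simp add: abs_mult)
      also have "\<dots> = \<bar>S n (g 1) x - S n (g (-1)) x\<bar>" using eq by (simp only:)
      finally have "2 * R < \<bar>S n (g 1) x - S n (g (-1)) x\<bar>" using l0 by simp
      then have "R < \<bar>S n (g 1) x\<bar> \<or> R < \<bar>S n (g (-1)) x\<bar>" by linarith
      then show "x \<in> E 1 \<union> E (-1)" using n(1) x by (auto simp: E_def)
    qed
  qed simp
  also have "\<dots> \<le> prob (E 1) + prob (E (-1))" by (intro measure_Un_le) auto
  finally have "\<epsilon> / 2 < prob (E 1) \<or> \<epsilon> / 2 < prob (E (-1))" using N by linarith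
  then obtain s where s: "s = 1 \<or> s = -1" "\<epsilon> / 2 < prob (E s)" by blast
  show thesis by (rule that[OF g[of s] close[OF s(1)] s(2)[unfolded E_def]])
qed


text \<open>
  A gliding hump argument. If the conclusion fails, perturb repeatedly: the sum \<open>f k\<close> of the first
  \<open>k\<close> perturbations has \<open>\<bar>S n (f k)\<bar>\<close> larger than \<open>k\<close> for some \<open>n\<close> below a finite bound \<open>N\<close>, on
  a set of measure at least \<open>\<epsilon> / 2\<close>. All later perturbations are chosen so small that their
  sum changes \<open>S n\<close> for \<open>n < N\<close> by at most \<open>1\<close>, up to measure \<open>\<epsilon> / 4\<close>. The full sum then has an
  infinite maximal function on a set of positive measure, although \<open>cosh\<close> of it is integrable.
\<close>

lemma (in prob_space) banach_principle:
  assumes lin: "\<And>n. linear_operator M (S n)" and bdd: "\<And>n. bounded_on_Lp M 2 (S n)"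
    and fin: "\<And>f. f \<in> borel_measurable M \<Longrightarrow> (\<integral>\<^sup>+x. ennreal (cosh (f x)) \<partial>M) < \<infinity> \<Longrightarrow>
      AE x in M. \<exists>B. \<forall>n::nat. \<bar>S n f x\<bar> \<le> B"
    and C: "0 < C" and \<epsilon>: "0 < (\<epsilon>::real)"
  shows "\<exists>R. \<forall>h\<in>borel_measurable M. (\<integral>\<^sup>+x. ennreal (cosh (h x)) \<partial>M) \<le> ennreal C \<longrightarrow>
    prob {x \<in> space M. \<exists>n. R < \<bar>S n h x\<bar>} \<le> \<epsilon>"
proof (rule ccontr)
  assume "\<not> ?thesis"
  then have bad: "\<And>R. \<exists>h\<in>borel_measurable M. (\<integral>\<^sup>+x. ennreal (cosh (h x)) \<partial>M) \<le> ennreal C \<and>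
      \<epsilon> < prob {x \<in> space M. \<exists>n. R < \<bar>S n h x\<bar>}"
    by (meson not_le)
  note [measurable] = linear_operator_measurable[OF lin]
  \<comment> \<open>A state consists of the function built so far and of a radius that limits all later
    perturbations; \<open>Q k\<close> relates the states before and after the perturbation number \<open>k\<close>.\<close>
  define P :: "nat \<Rightarrow> ('a \<Rightarrow> real) \<times> real \<Rightarrow> bool" where
    "P = (\<lambda>k y. fst y \<in> borel_measurable M \<and> 0 < snd y \<and> (k = 0 \<longrightarrow> fst y = (\<lambda>_. 0)))"
  define Q :: "nat \<Rightarrow> ('a \<Rightarrow> real) \<times> real \<Rightarrow> ('a \<Rightarrow> real) \<times> real \<Rightarrow> bool" where
    "Q = (\<lambda>k y z. snd z \<le> snd y
      \<and> (\<integral>\<^sup>+x. ennreal (cosh (2 ^ Suc k * (fst z x - fst y x)) - 1) \<partial>M) \<le> ennreal (snd y * (1 / 2) ^ Suc k)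
      \<and> (\<exists>N::nat. \<epsilon> / 2 < prob {x \<in> space M. \<exists>n<N. real k + 1 < \<bar>S n (fst z) x\<bar>}
          \<and> (\<forall>d\<in>borel_measurable M. (\<integral>\<^sup>+x. ennreal ((d x)\<^sup>2) \<partial>M) \<le> ennreal (2 * snd z) \<longrightarrow>
                prob {x \<in> space M. \<exists>n<N. 1 < \<bar>S n d x\<bar>} \<le> \<epsilon> / 4)))"
  have "\<exists>y. \<forall>k. P k (y k) \<and> Q k (y k) (y (Suc k))"
  proof (rule dependent_nat_choice)
    show "\<exists>y. P 0 y" by (rule exI[of _ "(\<lambda>_. 0, 1)"]) (simp add: P_def)
  next
    fix y k assume "P k y"
    then have y[measurable]: "fst y \<in> borel_measurable M" and r: "0 < snd y * (1 / 2) ^ Suc k"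
      by (auto simp: P_def)
    have L: "1 \<le> (2::real) ^ Suc k" by (rule one_le_power) simp
    obtain g N where g: "g \<in> borel_measurable M"
      and 1: "(\<integral>\<^sup>+x. ennreal (cosh (2 ^ Suc k * (g x - fst y x)) - 1) \<partial>M) \<le> ennreal (snd y * (1 / 2) ^ Suc k)"
      and 2: "\<epsilon> / 2 < prob {x \<in> space M. \<exists>n<N::nat. real k + 1 < \<bar>S n g x\<bar>}"
      by (rule gliding_hump_step[OF lin y r C L bad])
    have \<epsilon>4: "0 < \<epsilon> / 4" using \<epsilon> by simp
    obtain r where r: "0 < r" and 3: "\<And>d. d \<in> borel_measurable M \<Longrightarrow> (\<integral>\<^sup>+x. ennreal ((d x)\<^sup>2) \<partial>M) \<le> ennreal r \<Longrightarrow>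
        prob {x \<in> space M. \<exists>n<N. 1 < \<bar>S n d x\<bar>} \<le> \<epsilon> / 4"
      by (rule small_input_small_output[where S = S and N = N, OF lin bdd \<epsilon>4], rule that)
    define r' where "r' = min (snd y) (r / 2)"
    have r': "0 < r'" "r' \<le> snd y" "ennreal (2 * r') \<le> ennreal r"
      using r \<open>P k y\<close> by (auto simp: r'_def P_def intro!: ennreal_leI)
    show "\<exists>z. P (Suc k) z \<and> Q k y z"
    proof (intro exI[of _ "(g, r')"] conjI)
      show "P (Suc k) (g, r')" using g r' by (simp add: P_def)
      show "Q k y (g, r')" unfolding Q_def fst_conv snd_conv
      proof (intro conjI exI[of _ N] ballI impI)
        fix d :: "'a \<Rightarrow> real"
        assume "d \<in> borel_measurable M" "(\<integral>\<^sup>+x. ennreal ((d x)\<^sup>2) \<partial>M) \<le> ennreal (2 * r')"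
        then show "prob {x \<in> space M. \<exists>n<N. 1 < \<bar>S n d x\<bar>} \<le> \<epsilon> / 4"
          using r'(3) by (intro 3) (auto intro: order_trans)
      qed (fact r'(2) 1 2)+
    qed
  qed
  then obtain y where "\<forall>k. P k (y k) \<and> Q k (y k) (y (Suc k))" ..
  then have y: "P k (y k)" "Q k (y k) (y (Suc k))" for k by simp_all
  define f where "f = (\<lambda>k. fst (y k))"
  define r where "r = (\<lambda>k. snd (y k))"
  have fm[measurable]: "f k \<in> borel_measurable M" for k using y(1)[of k] by (simp add: P_def f_def)
  have r0: "0 < r k" for k using y(1)[of k] by (simp add: P_def r_def)
  have f0: "f 0 = (\<lambda>_. 0)" using y(1)[of 0] by (simp add: P_def f_def)
  have rdec: "decseq r" using y(2) unfolding Q_def r_def by (intro decseq_SucI) simp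
  define \<xi> where "\<xi> = (\<lambda>k x. f (Suc k) x - f k x)"
  have \<xi>m[measurable]: "\<xi> k \<in> borel_measurable M" for k unfolding \<xi>_def by measurable
  have w: "(\<integral>\<^sup>+x. ennreal (cosh (2 ^ Suc k * \<xi> k x) - 1) \<partial>M) \<le> ennreal (r k * (1 / 2) ^ Suc k)" for k
    using y(2)[of k] by (simp add: Q_def \<xi>_def f_def r_def)
  have fsum: "f k x = (\<Sum>j<k. \<xi> j x)" for k x
    by (induction k) (auto simp: f0 \<xi>_def)
  define tail where "tail = (\<lambda>k x. \<Sum>j. \<xi> (j + k) x)"
  have tailm[measurable]: "tail k \<in> borel_measurable M" for k unfolding tail_def by measurable
  have Ww: "(\<integral>\<^sup>+x. (\<Sum>j. ennreal (cosh (2 ^ Suc j * \<xi> (j + k) x) - 1)) \<partial>M) \<le> ennreal (r k)" for k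
  proof -
    have "(\<integral>\<^sup>+x. (\<Sum>j. ennreal (cosh (2 ^ Suc j * \<xi> (j + k) x) - 1)) \<partial>M)
        = (\<Sum>j. \<integral>\<^sup>+x. ennreal (cosh (2 ^ Suc j * \<xi> (j + k) x) - 1) \<partial>M)"
      by (rule nn_integral_suminf) measurable
    also have "\<dots> \<le> (\<Sum>j. ennreal (r k * (1 / 2) ^ Suc j))"
    proof (intro suminf_le summableI)
      fix j
      have "(\<integral>\<^sup>+x. ennreal (cosh (2 ^ Suc j * \<xi> (j + k) x) - 1) \<partial>M)
          \<le> (\<integral>\<^sup>+x. ennreal (cosh (2 ^ Suc (j + k) * \<xi> (j + k) x) - 1) \<partial>M)"
      proof (intro nn_integral_mono ennreal_leI diff_right_mono)
        fix x
        have "\<bar>2 ^ Suc j * \<xi> (j + k) x\<bar> \<le> \<bar>2 ^ Suc (j + k) * \<xi> (j + k) x\<bar>"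
          unfolding abs_mult by (intro mult_right_mono) (auto intro!: power_increasing)
        then have "cosh \<bar>2 ^ Suc j * \<xi> (j + k) x\<bar> \<le> cosh \<bar>2 ^ Suc (j + k) * \<xi> (j + k) x\<bar>"
          by (subst cosh_real_nonneg_le_iff) auto
        then show "cosh (2 ^ Suc j * \<xi> (j + k) x) \<le> cosh (2 ^ Suc (j + k) * \<xi> (j + k) x)"
          by (simp only: cosh_real_abs)
      qed
      also note w[of "j + k"]
      also have "ennreal (r (j + k) * (1 / 2) ^ Suc (j + k)) \<le> ennreal (r k * (1 / 2) ^ Suc j)"
        using decseqD[OF rdec, of k "j + k"] less_imp_le[OF r0]
        by (intro ennreal_leI mult_mono power_decreasing) auto
      finally show "(\<integral>\<^sup>+x. ennreal (cosh (2 ^ Suc j * \<xi> (j + k) x) - 1) \<partial>M) \<le> ennreal (r k * (1 / 2) ^ Suc j)" .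
    qed
    also have "(\<Sum>j. ennreal (r k * (1 / 2) ^ Suc j)) = ennreal (r k * 1)"
      using less_imp_le[OF r0] by (intro suminf_ennreal_eq sums_mult power_half_series) auto
    finally show ?thesis by simp
  qed
  have tail_cosh: "(\<integral>\<^sup>+x. ennreal (cosh (tail k x) - 1) \<partial>M) \<le> ennreal (r k)" for k
    unfolding tail_def by (rule order_trans[OF nn_integral_mono[OF cosh_suminf_ennreal(2)] Ww])
  have tail_sq: "(\<integral>\<^sup>+x. ennreal ((tail k x)\<^sup>2) \<partial>M) \<le> ennreal (2 * r k)" for k
  proof -
    have "(\<integral>\<^sup>+x. ennreal ((tail k x)\<^sup>2) \<partial>M) \<le> (\<integral>\<^sup>+x. ennreal 2 * ennreal (cosh (tail k x) - 1) \<partial>M)"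
    proof (rule nn_integral_mono)
      fix x
      show "ennreal ((tail k x)\<^sup>2) \<le> ennreal 2 * ennreal (cosh (tail k x) - 1)"
        unfolding ennreal_mult[symmetric, OF zero_le_numeral diff_ge_0_iff_ge[THEN iffD2, OF cosh_real_ge_1]]
        using half_square_le_cosh[of "tail k x"] by (intro ennreal_leI) simp
    qed
    also have "\<dots> = ennreal 2 * (\<integral>\<^sup>+x. ennreal (cosh (tail k x) - 1) \<partial>M)"
      by (rule nn_integral_cmult) measurable
    also have "\<dots> \<le> ennreal 2 * ennreal (r k)" using tail_cosh by (rule mult_left_mono) simp
    also have "\<dots> = ennreal (2 * r k)" using less_imp_le[OF r0] by (intro ennreal_mult[symmetric]) auto
    finally show ?thesis .
  qed
  have "AE x in M. (\<Sum>j. ennreal (cosh (2 ^ Suc j * \<xi> (j + 0) x) - 1)) \<noteq> \<infinity>"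
    using Ww[of 0] by (intro nn_integral_PInf_AE) (auto simp: top_unique)
  then have "AE x in M. summable (\<lambda>j. \<xi> j x)"
  proof eventually_elim
    case (elim x)
    then have "summable (\<lambda>j. \<bar>\<xi> (j + 0) x\<bar>)" by (rule cosh_suminf_ennreal(1))
    then show ?case by (simp add: summable_rabs_cancel)
  qed
  then have split: "AE x in M. tail 0 x = f k x + tail k x" for k
  proof eventually_elim
    case (elim x)
    show ?case using suminf_split_initial_segment[OF elim, of k] by (simp add: tail_def fsum)
  qed
  have "(\<integral>\<^sup>+x. ennreal (cosh (tail 0 x)) \<partial>M) = (\<integral>\<^sup>+x. ennreal (cosh (tail 0 x) - 1) + 1 \<partial>M)"
    by (intro nn_integral_cong) (simp add: cosh_real_ge_1 flip: ennreal_plus ennreal_1)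
  also have "\<dots> = (\<integral>\<^sup>+x. ennreal (cosh (tail 0 x) - 1) \<partial>M) + 1"
    by (subst nn_integral_add) (auto simp: emeasure_space_1)
  also have "\<dots> < \<infinity>" using le_less_trans[OF tail_cosh[of 0] ennreal_less_top] by (simp add: ennreal_add_less_top)
  finally have ae: "AE x in M. \<exists>B. \<forall>n. \<bar>S n (tail 0) x\<bar> \<le> B" by (intro fin) measurable
  define E where "E = (\<lambda>k::nat. {x \<in> space M. \<exists>n. real k < \<bar>S n (tail 0) x\<bar>})"
  have Em[measurable]: "E k \<in> events" for k unfolding E_def by measurable
  have big: "\<epsilon> / 4 \<le> prob (E k)" for k
  proof -
    obtain N where
      N0: "\<epsilon> / 2 < prob {x \<in> space M. \<exists>n<N. real k + 1 < \<bar>S n (fst (y (Suc k))) x\<bar>}"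
      and N1: "\<forall>d\<in>borel_measurable M. (\<integral>\<^sup>+x. ennreal ((d x)\<^sup>2) \<partial>M) \<le> ennreal (2 * snd (y (Suc k))) \<longrightarrow>
        prob {x \<in> space M. \<exists>n<N. 1 < \<bar>S n d x\<bar>} \<le> \<epsilon> / 4"
      using y(2)[of k] unfolding Q_def by (elim conjE exE) (rule that)
    have N: "\<epsilon> / 2 < prob {x \<in> space M. \<exists>n<N. real k + 1 < \<bar>S n (f (Suc k)) x\<bar>}"
      using N0 by (simp only: f_def)
    have N': "prob {x \<in> space M. \<exists>n<N. 1 < \<bar>S n (tail (Suc k)) x\<bar>} \<le> \<epsilon> / 4"
      using N1[rule_format, OF tailm[of "Suc k"]] tail_sq[of "Suc k"] by (simp only: r_def)
    have "AE x in M. \<forall>n. S n (\<lambda>x. f (Suc k) x + tail (Suc k) x) x = S n (f (Suc k)) x + S n (tail (Suc k)) x"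
      unfolding AE_all_countable by (intro allI linear_operator_add[OF lin]) measurable
    moreover have "AE x in M. \<forall>n. S n (\<lambda>y. tail 0 y - (f (Suc k) y + tail (Suc k) y)) x = S n (tail 0) x - S n (\<lambda>x. f (Suc k) x + tail (Suc k) x) x"
      unfolding AE_all_countable by (intro allI linear_operator_diff[OF lin]) measurable
    moreover have "AE x in M. \<forall>n. S n (\<lambda>y. tail 0 y - (f (Suc k) y + tail (Suc k) y)) x = 0"
      unfolding AE_all_countable
      using split[of "Suc k"] by (intro allI bounded_on_L2_AE_zero[OF bdd lin]) auto
    ultimately have "AE x in M. \<forall>n. S n (tail 0) x = S n (f (Suc k)) x + S n (tail (Suc k)) x"
      by eventually_elim simp
    then have "AE x in M. x \<in> {x \<in> space M. \<exists>n<N. real k + 1 < \<bar>S n (f (Suc k)) x\<bar>} \<longrightarrow>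
        x \<in> E k \<union> {x \<in> space M. \<exists>n<N. 1 < \<bar>S n (tail (Suc k)) x\<bar>}"
    proof (rule AE_mp, intro AE_I2 impI)
      fix x assume x: "x \<in> space M" and eq: "\<forall>n. S n (tail 0) x = S n (f (Suc k)) x + S n (tail (Suc k)) x"
        and "x \<in> {x \<in> space M. \<exists>n<N. real k + 1 < \<bar>S n (f (Suc k)) x\<bar>}"
      then obtain n where n: "n < N" "real k + 1 < \<bar>S n (f (Suc k)) x\<bar>" by blast
      have "real k < \<bar>S n (tail 0) x\<bar> \<or> 1 < \<bar>S n (tail (Suc k)) x\<bar>"
        using n(2) eq[rule_format, of n] by linarith
      then show "x \<in> E k \<union> {x \<in> space M. \<exists>n<N. 1 < \<bar>S n (tail (Suc k)) x\<bar>}"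
        using n(1) x by (auto simp: E_def)
    qed
    then have "prob {x \<in> space M. \<exists>n<N. real k + 1 < \<bar>S n (f (Suc k)) x\<bar>}
        \<le> prob (E k \<union> {x \<in> space M. \<exists>n<N. 1 < \<bar>S n (tail (Suc k)) x\<bar>})"
      by (rule finite_measure_mono_AE) measurable
    also have "\<dots> \<le> prob (E k) + prob {x \<in> space M. \<exists>n<N. 1 < \<bar>S n (tail (Suc k)) x\<bar>}"
      by (intro measure_Un_le) measurable
    finally show ?thesis using N N' by linarith
  qed
  have "(\<lambda>k. prob (E k)) \<longlonglongrightarrow> prob (\<Inter>k. E k)"
  proof (rule finite_Lim_measure_decseq)
    show "decseq E"
    proof (rule decseq_SucI, rule subsetI)
      fix k x assume "x \<in> E (Suc k)"
      then obtain n where "x \<in> space M" "real (Suc k) < \<bar>S n (tail 0) x\<bar>" by (auto simp: E_def)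
      moreover from this have "real k < \<bar>S n (tail 0) x\<bar>" by simp
      ultimately show "x \<in> E k" unfolding E_def by blast
    qed
  qed auto
  then have "\<epsilon> / 4 \<le> prob (\<Inter>k. E k)" using big by (intro LIMSEQ_le_const) auto
  moreover have "AE x in M. x \<notin> (\<Inter>k. E k)"
    using ae
  proof eventually_elim
    case (elim x)
    then obtain B where B: "\<And>n. \<bar>S n (tail 0) x\<bar> \<le> B" by blast
    obtain k where "B \<le> real k" using real_arch_simple by blast
    then have "\<not> real k < \<bar>S n (tail 0) x\<bar>" for n using B[of n] by linarith
    then have "x \<notin> E k" unfolding E_def by blast
    then show ?case by blast
  qed
  then have "prob (\<Inter>k. E k) = 0"
    by (subst prob_eq_0) auto
  ultimately show False using \<epsilon> by simp
qed

section \<open>Averages along a Bourgain sequence\<close>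

lemma bourgain_sequenceD:
  assumes "bourgain_sequence M T" and "j \<ge> 1"
  shows "linear_operator M (T j)" "bounded_on_Lp M 1 (T j)" "isometry_on_Lp M 2 (T j)"
    "positive_operator M (T j)" "AE x in M. T j (\<lambda>_. 1) x = 1"
  using assms by (auto simp: bourgain_sequence_def)

lemma Lp_space_1: "Lp_space M 1 = {f \<in> borel_measurable M. integrable M f}"
  unfolding Lp_space_def by (auto simp: integrable_abs_iff)

lemma Lp_norm_1: "Lp_norm M 1 f = (\<integral>x. \<bar>f x\<bar> \<partial>M)"
  by (simp add: Lp_norm_def)

lemma isometry_on_L2_square:
  assumes T: "isometry_on_Lp M 2 T" and h: "h \<in> borel_measurable M" "integrable M (\<lambda>x. (h x)\<^sup>2)"
  shows "integrable M (\<lambda>x. (T h x)\<^sup>2)" and "(\<integral>x. (T h x)\<^sup>2 \<partial>M) = (\<integral>x. (h x)\<^sup>2 \<partial>M)"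
  using T h by (auto simp: isometry_on_Lp_def Lp_space_2 Lp_norm_2)

lemma linear_operator_const:
  assumes T: "linear_operator M T" and 1: "AE x in M. T (\<lambda>_. 1) x = 1"
  shows "AE x in M. T (\<lambda>_. c) x = c"
proof -
  have "AE x in M. T (\<lambda>_. c * 1) x = c * T (\<lambda>_. 1) x"
    by (rule linear_operator_scale[OF T]) measurable
  with 1 show ?thesis by eventually_elim simp
qed

lemma positive_operator_mono:
  assumes T: "linear_operator M T" "positive_operator M T"
    and [measurable]: "f \<in> borel_measurable M" "g \<in> borel_measurable M"
    and le: "AE x in M. f x \<le> g x"
  shows "AE x in M. T f x \<le> T g x"
proof -
  have "AE x in M. 0 \<le> T (\<lambda>y. g y - f y) x"
    by (rule T(2)[unfolded positive_operator_def, rule_format]) (use le in auto)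
  moreover have "AE x in M. T (\<lambda>y. g y - f y) x = T g x - T f x"
    by (rule linear_operator_diff[OF T(1)]) measurable
  ultimately show ?thesis by eventually_elim simp
qed

lemma positive_operator_bounded:
  assumes T: "linear_operator M T" "positive_operator M T" "AE x in M. T (\<lambda>_. 1) x = 1"
    and [measurable]: "f \<in> borel_measurable M" and K: "\<And>x. \<bar>f x\<bar> \<le> K"
  shows "AE x in M. \<bar>T f x\<bar> \<le> K"
proof -
  have "AE x in M. T f x \<le> T (\<lambda>_. K) x"
    using K by (intro positive_operator_mono[OF T(1,2)]) (auto simp: abs_le_iff)
  moreover have "AE x in M. T (\<lambda>_. - K) x \<le> T f x"
    using K by (intro positive_operator_mono[OF T(1,2)]) (auto simp: abs_le_iff minus_le_iff)
  moreover note linear_operator_const[OF T(1,3), of K] linear_operator_const[OF T(1,3), of "- K"]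
  ultimately show ?thesis by eventually_elim simp
qed

text \<open>
  Jensen's inequality for \<open>T\<close>: the parabola is the supremum of its tangents
  \<open>t \<mapsto> 2 * c * t - c\<^sup>2\<close>. Rational slopes suffice and keep the exceptional sets countable in number.
\<close>

lemma positive_operator_square_le:
  assumes T: "linear_operator M T" "positive_operator M T" "AE x in M. T (\<lambda>_. 1) x = 1"
    and h[measurable]: "h \<in> borel_measurable M"
  shows "AE x in M. (T h x)\<^sup>2 \<le> T (\<lambda>y. (h y)\<^sup>2) x"
proof -
  have "AE x in M. \<forall>c. 2 * of_rat c * T h x - (of_rat c)\<^sup>2 \<le> T (\<lambda>y. (h y)\<^sup>2) x"
    unfolding AE_all_countable
  proof
    fix c :: rat
    define r :: real where "r = of_rat c"
    have "AE x in M. T (\<lambda>y. 2 * r * h y - r\<^sup>2) x \<le> T (\<lambda>y. (h y)\<^sup>2) x"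
    proof (intro positive_operator_mono[OF T(1,2)] AE_I2)
      fix x show "2 * r * h x - r\<^sup>2 \<le> (h x)\<^sup>2"
        using zero_le_power2[of "h x - r"] by (simp add: power2_diff algebra_simps)
    qed measurable
    moreover have "AE x in M. T (\<lambda>y. 2 * r * h y - r\<^sup>2) x = T (\<lambda>y. 2 * r * h y) x - T (\<lambda>y. r\<^sup>2) x"
      by (rule linear_operator_diff[OF T(1)]) measurable
    moreover have "AE x in M. T (\<lambda>y. 2 * r * h y) x = 2 * r * T h x"
      by (rule linear_operator_scale[OF T(1) h])
    moreover note linear_operator_const[OF T(1,3), of "r\<^sup>2"]
    ultimately show "AE x in M. 2 * of_rat c * T h x - (of_rat c)\<^sup>2 \<le> T (\<lambda>y. (h y)\<^sup>2) x"
      unfolding r_def[symmetric] by eventually_elim simp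
  qed
  then show ?thesis
  proof eventually_elim
    case (elim x)
    show ?case
    proof (rule ccontr)
      assume "\<not> ?case"
      then have gap: "0 < (T h x)\<^sup>2 - T (\<lambda>y. (h y)\<^sup>2) x" (is "0 < ?d") by simp
      then obtain r where r: "r \<in> \<rat>" "T h x < r" "r < T h x + sqrt ?d"
        using Rats_dense_in_real[of "T h x" "T h x + sqrt ?d"] by auto
      then obtain c where c: "r = of_rat c" by (auto elim: Rats_cases)
      have "(r - T h x)\<^sup>2 < (sqrt ?d)\<^sup>2" using r by (intro power_strict_mono) auto
      then have "(r - T h x)\<^sup>2 < ?d" using gap by simp
      then show False using elim[rule_format, of c] c by (simp add: power2_diff algebra_simps)
    qed
  qed
qed

text \<open>
  The ergodic condition applied to \<open>h\<^sup>2\<close> concerns the averages of \<open>T j (h\<^sup>2)\<close>. These dominate the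
  averages of \<open>(T j h)\<^sup>2\<close> pointwise, whereas the integrals of both tend to \<open>\<integral> h\<^sup>2\<close>, those of the
  latter by the isometry property. Hence the two averages are close in \<open>L\<^sup>1\<close>.
\<close>

lemma (in prob_space) bourgain_square_average:
  assumes T: "bourgain_sequence M T"
    and h[measurable]: "h \<in> borel_measurable M" and int: "integrable M (\<lambda>x. (h x)\<^sup>2)"
  shows "(\<lambda>J. \<integral>x. \<bar>(\<Sum>j=1..J. (T j h x)\<^sup>2) / real J - (\<integral>y. (h y)\<^sup>2 \<partial>M)\<bar> \<partial>M) \<longlonglongrightarrow> 0"
proof -
  note D = bourgain_sequenceD[OF T]
  let ?m = "\<integral>y. (h y)\<^sup>2 \<partial>M"
  define A where "A = (\<lambda>J x. (1 / real J) * (\<Sum>j=1..J. T j (\<lambda>y. (h y)\<^sup>2) x))"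
  define B where "B = (\<lambda>J x. (\<Sum>j=1..J. (T j h x)\<^sup>2) / real J)"
  have h2: "(\<lambda>y. (h y)\<^sup>2) \<in> Lp_space M 1" using int by (simp add: Lp_space_1)
  have intA: "integrable M (T j (\<lambda>y. (h y)\<^sup>2))" if "j \<ge> 1" for j
    using D(2)[OF that] h2 unfolding bounded_on_Lp_def Lp_space_1 by blast
  have intB: "integrable M (\<lambda>x. (T j h x)\<^sup>2)" "(\<integral>x. (T j h x)\<^sup>2 \<partial>M) = ?m" if "j \<ge> 1" for j
    using isometry_on_L2_square[OF D(3)[OF that] h int] .
  have iA: "integrable M (A J)" for J unfolding A_def
    by (intro integrable_mult_right Bochner_Integration.integrable_sum intA) auto
  have iB: "integrable M (B J)" for J unfolding B_def
    by (intro integrable_divide Bochner_Integration.integrable_sum intB(1)) auto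
  have lim: "(\<lambda>J. 2 * (\<integral>x. \<bar>A J x - ?m\<bar> \<partial>M)) \<longlonglongrightarrow> 0"
  proof (rule tendsto_mult_right_zero)
    show "(\<lambda>J. \<integral>x. \<bar>A J x - ?m\<bar> \<partial>M) \<longlonglongrightarrow> 0"
      using T h2 unfolding bourgain_sequence_def Lp_norm_1 A_def by blast
  qed
  have "(\<integral>x. \<bar>B J x - ?m\<bar> \<partial>M) \<le> 2 * (\<integral>x. \<bar>A J x - ?m\<bar> \<partial>M)" if J: "J \<ge> 1" for J
  proof -
    have "AE x in M. \<forall>j\<in>{1..J}. (T j h x)\<^sup>2 \<le> T j (\<lambda>y. (h y)\<^sup>2) x"
      using D by (intro AE_finite_allI positive_operator_square_le h) auto
    then have BA: "AE x in M. B J x \<le> A J x"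
      by eventually_elim (auto simp: A_def B_def intro!: divide_right_mono sum_mono)
    have mB: "(\<integral>x. B J x \<partial>M) = ?m"
      unfolding B_def using intB J by (simp add: integral_sum)
    \<comment> \<open>Since \<open>A J - B J\<close> is nonnegative, its \<open>L\<^sup>1\<close> norm is its integral, that is \<open>\<integral> (A J - ?m)\<close>.\<close>
    have "(\<integral>x. \<bar>B J x - ?m\<bar> \<partial>M) \<le> (\<integral>x. \<bar>A J x - ?m\<bar> + (A J x - B J x) \<partial>M)"
      using iA iB BA by (intro integral_mono_AE) (auto elim!: eventually_mono)
    also have "\<dots> = (\<integral>x. \<bar>A J x - ?m\<bar> \<partial>M) + (\<integral>x. A J x - ?m \<partial>M)"
      using iA iB by (simp add: mB prob_space)
    also have "(\<integral>x. A J x - ?m \<partial>M) \<le> (\<integral>x. \<bar>A J x - ?m\<bar> \<partial>M)"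
      using iA by (intro integral_mono) auto
    finally show ?thesis by simp
  qed
  then have "\<forall>\<^sub>F J in sequentially. (\<integral>x. \<bar>B J x - ?m\<bar> \<partial>M) \<le> 2 * (\<integral>x. \<bar>A J x - ?m\<bar> \<partial>M)"
    by (auto simp: eventually_sequentially intro!: exI[of _ 1])
  then have "(\<lambda>J. \<integral>x. \<bar>B J x - ?m\<bar> \<partial>M) \<longlonglongrightarrow> 0"
    by (intro tendsto_sandwich[OF _ _ tendsto_const lim]) auto
  then show ?thesis by (simp only: B_def)
qed

text \<open>
  Boundedness of \<open>f\<close> makes the averages uniformly bounded, so that \<open>exp\<close> is Lipschitz on their
  range and convergence in \<open>L\<^sup>1\<close> carries over. The limit \<open>exp (\<integral> f\<^sup>2 / 2)\<close> is at most
  \<open>exp (1 / 2) < 2\<close>.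
\<close>

lemma (in prob_space) bourgain_exp_average:
  assumes T: "bourgain_sequence M T"
    and f[measurable]: "f \<in> borel_measurable M" and K: "\<And>x. \<bar>f x\<bar> \<le> K" and le: "(\<integral>x. (f x)\<^sup>2 \<partial>M) \<le> 1"
  shows "\<forall>\<^sub>F J in sequentially. (\<integral>\<^sup>+x. ennreal (exp ((\<Sum>j=1..J. (T j f x)\<^sup>2) / real J / 2)) \<partial>M) \<le> 3"
proof -
  note D = bourgain_sequenceD[OF T]
  have f2: "(f x)\<^sup>2 \<le> K\<^sup>2" for x using K[of x] by (simp add: abs_le_square_iff[symmetric])
  have int: "integrable M (\<lambda>x. (f x)\<^sup>2)"
    using f2 by (intro integrable_const_bound[of _ "K\<^sup>2"]) auto
  let ?m = "\<integral>y. (f y)\<^sup>2 \<partial>M"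
  define B where "B = (\<lambda>J x. (\<Sum>j=1..J. (T j f x)\<^sup>2) / real J)"
  have iB: "integrable M (B J)" for J 
    unfolding B_def
    by (intro integrable_divide Bochner_Integration.integrable_sum isometry_on_L2_square(1)[OF D(3) f int]) auto
  note [measurable] = borel_measurable_integrable[OF iB]
  let ?c = "exp (K\<^sup>2 / 2) / 2"
  have "(\<lambda>J. \<integral>x. \<bar>B J x - ?m\<bar> \<partial>M) \<longlonglongrightarrow> 0"
    unfolding B_def by (rule bourgain_square_average[OF T f int])
  then have "(\<lambda>J. ?c * (\<integral>x. \<bar>B J x - ?m\<bar> \<partial>M)) \<longlonglongrightarrow> 0" by (rule tendsto_mult_right_zero)
  then have "\<forall>\<^sub>F J in sequentially. ?c * (\<integral>x. \<bar>B J x - ?m\<bar> \<partial>M) < 1"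
    by (rule order_tendstoD) simp
  then show ?thesis
    using eventually_ge_at_top[of 1]
  proof eventually_elim
    case (elim J)
    have "AE x in M. \<forall>j\<in>{1..J}. \<bar>T j f x\<bar> \<le> K"
      using D by (intro AE_finite_allI positive_operator_bounded f K) auto
    then have BK: "AE x in M. B J x \<le> K\<^sup>2"
    proof eventually_elim
      case (elim x)
      have "(\<Sum>j=1..J. (T j f x)\<^sup>2) \<le> (\<Sum>j=1..J. K\<^sup>2)"
        using elim by (intro sum_mono) (auto simp: abs_le_square_iff[symmetric] intro: order_trans[OF _ abs_ge_self])
      then show ?case using \<open>1 \<le> J\<close> by (simp add: B_def field_simps)
    qed
    have "(\<integral>\<^sup>+x. ennreal (exp (B J x / 2)) \<partial>M) \<le> (\<integral>\<^sup>+x. ennreal (exp (1 / 2) + ?c * \<bar>B J x - ?m\<bar>) \<partial>M)"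
    proof (rule nn_integral_mono_AE, use BK in eventually_elim)
      case (elim x)
      \<comment> \<open>The tangent inequality of \<open>exp\<close> at \<open>B J x / 2\<close> gives the Lipschitz bound.\<close>
      have "1 + (?m / 2 - B J x / 2) \<le> exp (?m / 2 - B J x / 2)" by (rule exp_ge_add_one_self)
      then have "exp (B J x / 2) * (1 + (?m / 2 - B J x / 2)) \<le> exp (B J x / 2) * exp (?m / 2 - B J x / 2)"
        by (intro mult_left_mono) auto
      also have "\<dots> = exp (?m / 2)" by (simp flip: exp_add)
      finally have "exp (B J x / 2) \<le> exp (?m / 2) + exp (B J x / 2) / 2 * (B J x - ?m)"
        by (simp add: algebra_simps)
      also have "\<dots> \<le> exp (?m / 2) + exp (B J x / 2) / 2 * \<bar>B J x - ?m\<bar>"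
        by (intro add_left_mono mult_left_mono) auto
      also have "\<dots> \<le> exp (1 / 2) + ?c * \<bar>B J x - ?m\<bar>"
        using le elim by (intro add_mono mult_right_mono) auto
      finally show ?case by (rule ennreal_leI)
    qed
    also have "\<dots> = ennreal (\<integral>x. exp (1 / 2) + ?c * \<bar>B J x - ?m\<bar> \<partial>M)"
      using iB by (intro nn_integral_eq_integral) auto
    also have "(\<integral>x. exp (1 / 2) + ?c * \<bar>B J x - ?m\<bar> \<partial>M) = exp (1 / 2) + ?c * (\<integral>x. \<bar>B J x - ?m\<bar> \<partial>M)"
      using iB by (simp add: prob_space)
    also have "ennreal \<dots> \<le> ennreal 3"
      using elim exp_half_le2 by (intro ennreal_leI) linarith
    finally show ?case by (simp add: B_def)
  qed
qed

section \<open>Separated orbits\<close>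

text \<open>
  The transfer to a Gaussian process. Three exceptional sets are controlled: the \<open>g\<close> with
  \<open>\<integral> cosh F > 48\<close> (measure at most \<open>3 / 48\<close>), the points \<open>x\<close> at which the process reaches \<open>R + 1\<close>
  with probability at least \<open>1 / 4\<close> (measure at most \<open>4 * (1 / 16 + 1 / 16)\<close>), and the points \<open>x\<close> at which
  separation is lost (measure at most \<open>1 / 4\<close>). The last two leave room for a good point \<open>x\<close>.
\<close>

lemma (in prob_space) orbit_separation_bound:
  assumes T: "bourgain_sequence M T"
    and lin: "\<And>n. linear_operator M (S n)" and bdd: "\<And>n. bounded_on_Lp M 2 (S n)"
    and comm: "\<And>n j. j \<ge> 1 \<Longrightarrow> operators_commute M (S n) (T j)"
    and R: "\<And>h. h \<in> borel_measurable M \<Longrightarrow> (\<integral>\<^sup>+x. ennreal (cosh (h x)) \<partial>M) \<le> ennreal 48 \<Longrightarrow>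
      prob {x \<in> space M. \<exists>n::nat. R < \<bar>S n h x\<bar>} \<le> 1 / 16"
    and f[measurable]: "f \<in> borel_measurable M" and K: "\<And>x. \<bar>f x\<bar> \<le> K" and le: "(\<integral>x. (f x)\<^sup>2 \<partial>M) \<le> 1"
    and A: "finite A" "A \<noteq> {}" and \<epsilon>: "\<epsilon> > 0"
    and sep: "\<And>p q. p \<in> A \<Longrightarrow> q \<in> A \<Longrightarrow> p \<noteq> q \<Longrightarrow> 2 * \<epsilon>\<^sup>2 \<le> (\<integral>x. (S p f x - S q f x)\<^sup>2 \<partial>M)"
  shows "ln (real (card A)) \<le> 256 / 3 * (R + 1)\<^sup>2 / \<epsilon>\<^sup>2"
proof -
  note TD = bourgain_sequenceD[OF T]
  note Sm[measurable] = linear_operator_measurable[OF lin]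
  have f2: "(f x)\<^sup>2 \<le> K\<^sup>2" for x using K[of x] by (simp add: abs_le_square_iff[symmetric])
  have int: "integrable M (\<lambda>x. (f x)\<^sup>2)"
    using f2 by (intro integrable_const_bound[of _ "K\<^sup>2"]) auto
  have intS: "integrable M (\<lambda>x. (S n f x)\<^sup>2)" for n
    using bounded_on_L2_square[OF bdd[of n]] f int by metis
  define h where "h = (\<lambda>p q x. S p f x - S q f x)"
  have hm[measurable]: "h p q \<in> borel_measurable M" for p q unfolding h_def by measurable
  have inth: "integrable M (\<lambda>x. (h p q x)\<^sup>2)" for p q
    unfolding h_def using intS by (intro integrable_square_diff) auto
  let ?N = "real (card A)"
  have N: "?N > 0" using A by (simp add: card_gt_0_iff)
  \<comment> \<open>There are at most \<open>?N * ?N\<close> pairs, and each may spoil a set of measure \<open>\<eta> / \<epsilon>\<^sup>2\<close>.\<close>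
  define \<eta> where "\<eta> = \<epsilon>\<^sup>2 / (4 * ?N * ?N)"
  have \<eta>: "\<eta> > 0" using \<epsilon> N by (simp add: \<eta>_def)
  define B where "B = (\<lambda>J p q x. (\<Sum>j=1..J. (T j (h p q) x)\<^sup>2) / real J)"
  define m where "m = (\<lambda>p q. \<integral>y. (h p q y)\<^sup>2 \<partial>M)"
  have "\<forall>\<^sub>F J in sequentially. \<forall>p\<in>A. \<forall>q\<in>A. (\<integral>x. \<bar>B J p q x - m p q\<bar> \<partial>M) < \<eta>"
    using bourgain_square_average[OF T hm inth] \<eta> unfolding B_def m_def
    by (intro eventually_ball_finite A ballI order_tendstoD) auto
  moreover note bourgain_exp_average[OF T f K le]
  ultimately have "\<forall>\<^sub>F J in sequentially. (\<forall>p\<in>A. \<forall>q\<in>A. (\<integral>x. \<bar>B J p q x - m p q\<bar> \<partial>M) < \<eta>)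
     \<and> (\<integral>\<^sup>+x. ennreal (exp ((\<Sum>j=1..J. (T j f x)\<^sup>2) / real J / 2)) \<partial>M) \<le> 3 \<and> J \<ge> 1"
    using eventually_ge_at_top[of 1] by eventually_elim blast
  then obtain J where J1: "\<And>p q. p \<in> A \<Longrightarrow> q \<in> A \<Longrightarrow> (\<integral>x. \<bar>B J p q x - m p q\<bar> \<partial>M) < \<eta>"
    and J2: "(\<integral>\<^sup>+x. ennreal (exp ((\<Sum>j=1..J. (T j f x)\<^sup>2) / real J / 2)) \<partial>M) \<le> 3" and J: "J \<ge> 1"
    unfolding eventually_sequentially by blast
  define I where "I = {1..J}"
  have I: "finite I" and I1: "\<And>j. j \<in> I \<Longrightarrow> j \<ge> 1" by (auto simp: I_def)
  have Tm[measurable]: "\<And>j g. j \<in> I \<Longrightarrow> g \<in> borel_measurable M \<Longrightarrow> T j g \<in> borel_measurable M"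
    using linear_operator_measurable[OF TD(1)[OF I1]] by blast
  define a where "a = (\<lambda>n x j. T j (S n f) x / sqrt (real J))"
  have am[measurable]: "j \<in> I \<Longrightarrow> (\<lambda>x. a n x j) \<in> borel_measurable M" for j n unfolding a_def by measurable
  define F where "F = (\<lambda>g x. \<Sum>j\<in>I. T j f x / sqrt (real J) * g j)"
  interpret G: prob_space "gauss I" by (rule prob_space_gauss)
  interpret P: pair_sigma_finite "gauss I" M ..
  have coord[measurable]: "j \<in> I \<Longrightarrow> (\<lambda>g. g j) \<in> borel_measurable (gauss I)" for j by measurable
  have Fm[measurable]: "(\<lambda>(g, x). F g x) \<in> borel_measurable (gauss I \<Otimes>\<^sub>M M)"
    unfolding F_def by measurable
  have Fm'[measurable]: "F g \<in> borel_measurable M" for g unfolding F_def by measurable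

  have SF: "AE x in M. \<forall>n. S n (F g) x = (\<Sum>j\<in>I. a n x j * g j)" for g
    unfolding AE_all_countable
  proof
    fix n
    have Feq: "F g = (\<lambda>x. \<Sum>j\<in>I. (g j / sqrt (real J)) * T j f x)"
      unfolding F_def by (intro ext sum.cong) auto
    have "AE x in M. S n (F g) x = (\<Sum>j\<in>I. (g j / sqrt (real J)) * S n (T j f) x)"
      unfolding Feq using Tm f by (intro linear_operator_sum[OF lin I]) auto
    moreover have "AE x in M. \<forall>j\<in>I. S n (T j f) x = T j (S n f) x"
      using comm[OF I1] f unfolding operators_commute_def by (intro AE_finite_allI I) blast
    ultimately show "AE x in M. S n (F g) x = (\<Sum>j\<in>I. a n x j * g j)"
      by eventually_elim (auto simp: a_def intro!: sum.cong)
  qed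

  have [measurable]: "(\<lambda>y. \<Sum>j\<in>I. a n (snd y) j * fst y j) \<in> borel_measurable (gauss I \<Otimes>\<^sub>M M)" for n
    by (intro borel_measurable_sum borel_measurable_times
        measurable_compose[OF measurable_snd am] measurable_compose[OF measurable_fst coord])
  define Z where "Z = {y \<in> space (gauss I \<Otimes>\<^sub>M M). \<exists>n\<in>A. R + 1 \<le> \<bar>\<Sum>j\<in>I. a n (snd y) j * fst y j\<bar>}"
  have Zm[measurable]: "Z \<in> sets (gauss I \<Otimes>\<^sub>M M)"
    unfolding Z_def using A(1) by measurable
  define Phi where "Phi = (\<lambda>g. \<integral>\<^sup>+x. ennreal (cosh (F g x)) \<partial>M)"
  have Phim[measurable]: "Phi \<in> borel_measurable (gauss I)" unfolding Phi_def by measurable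
  have "(\<integral>\<^sup>+g. Phi g \<partial>gauss I) = (\<integral>\<^sup>+x. \<integral>\<^sup>+g. ennreal (cosh (F g x)) \<partial>gauss I \<partial>M)"
    unfolding Phi_def by (rule P.Fubini'[symmetric]) measurable
  also have "\<dots> = (\<integral>\<^sup>+x. ennreal (exp ((\<Sum>j=1..J. (T j f x)\<^sup>2) / real J / 2)) \<partial>M)"
    unfolding F_def gauss_cosh[OF I] by (simp add: power_divide I_def sum_divide_distrib)
  finally have Phi3: "(\<integral>\<^sup>+g. Phi g \<partial>gauss I) \<le> 3" using J2 by simp
  define H where "H = {g \<in> space (gauss I). 1 \<le> ennreal (1 / 48) * Phi g}"
  have Hm[measurable]: "H \<in> sets (gauss I)" unfolding H_def by measurable
  have "emeasure (gauss I) H \<le> ennreal (1 / 48) * (\<integral>\<^sup>+g. Phi g * indicator (space (gauss I)) g \<partial>gauss I)"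
    unfolding H_def by (rule nn_integral_Markov_inequality) auto
  also have "\<dots> = ennreal (1 / 48) * (\<integral>\<^sup>+g. Phi g \<partial>gauss I)"
    by (intro arg_cong2[where f = "(*)"] nn_integral_cong) auto
  also have "\<dots> \<le> ennreal (1 / 48) * ennreal 3" using Phi3 by (intro mult_left_mono) auto
  also have "\<dots> = ennreal (1 / 16)" by (subst ennreal_mult[symmetric]) auto
  finally have H16: "emeasure (gauss I) H \<le> ennreal (1 / 16)" .
  have slice: "emeasure M (Pair g -` Z) \<le> ennreal (1 / 16) + indicator H g" if g: "g \<in> space (gauss I)" for g
  proof (cases "g \<in> H")
    case True
    have "emeasure M (Pair g -` Z) \<le> 1" by (rule emeasure_le_1)
    also have "1 \<le> ennreal (1 / 16) + indicator H g" using True by simp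
    finally show ?thesis .
  next
    case False
    then have "ennreal (1 / 48) * Phi g < 1" using g by (simp add: H_def not_le)
    then have "ennreal 48 * (ennreal (1 / 48) * Phi g) \<le> ennreal 48 * 1" by (intro mult_left_mono) auto
    also have "ennreal 48 * (ennreal (1 / 48) * Phi g) = Phi g"
      unfolding mult.assoc[symmetric] by (subst ennreal_mult[symmetric]) auto
    finally have "prob {x \<in> space M. \<exists>n. R < \<bar>S n (F g) x\<bar>} \<le> 1 / 16"
      by (intro R) (simp_all add: Phi_def)
    moreover have "emeasure M (Pair g -` Z) \<le> emeasure M {x \<in> space M. \<exists>n. R < \<bar>S n (F g) x\<bar>}"
    proof (rule emeasure_mono_AE)
      show "AE x in M. x \<in> Pair g -` Z \<longrightarrow> x \<in> {x \<in> space M. \<exists>n. R < \<bar>S n (F g) x\<bar>}"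
        using SF[of g]
      proof eventually_elim
        case (elim x)
        show ?case
        proof
          assume "x \<in> Pair g -` Z"
          then obtain n where "x \<in> space M" "R + 1 \<le> \<bar>\<Sum>j\<in>I. a n x j * g j\<bar>"
            by (auto simp: Z_def space_pair_measure)
          moreover from this have "R < \<bar>S n (F g) x\<bar>" using elim by simp
          ultimately show "x \<in> {x \<in> space M. \<exists>n. R < \<bar>S n (F g) x\<bar>}" by blast
        qed
      qed
    qed measurable
    ultimately have "emeasure M (Pair g -` Z) \<le> ennreal (1 / 16)"
      by (simp add: emeasure_eq_measure ennreal_leI order_trans)
    then show ?thesis using False by simp
  qed
  define z where "z = (\<lambda>x. emeasure (gauss I) ((\<lambda>g. (g, x)) -` Z))"
  have zm[measurable]: "z \<in> borel_measurable M"
    unfolding z_def by (rule P.measurable_emeasure_Pair2[OF Zm])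
  have "(\<integral>\<^sup>+x. z x \<partial>M) = emeasure (gauss I \<Otimes>\<^sub>M M) Z"
    unfolding z_def by (rule P.emeasure_pair_measure_alt2[OF Zm, symmetric])
  also have "\<dots> = (\<integral>\<^sup>+g. emeasure M (Pair g -` Z) \<partial>gauss I)"
    by (rule emeasure_pair_measure_alt[OF Zm])
  also have "\<dots> \<le> (\<integral>\<^sup>+g. ennreal (1 / 16) + indicator H g \<partial>gauss I)"
    using slice by (rule nn_integral_mono)
  also have "\<dots> = ennreal (1 / 16) + emeasure (gauss I) H"
    by (subst nn_integral_add) (auto simp: G.emeasure_space_1)
  also have "\<dots> \<le> ennreal (1 / 16) + ennreal (1 / 16)" using H16 by (rule add_left_mono)
  finally have z8: "(\<integral>\<^sup>+x. z x \<partial>M) \<le> ennreal (1 / 8)" by (simp flip: ennreal_plus)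
  define V where "V = {x \<in> space M. 1 \<le> ennreal 4 * z x}"
  have Vm[measurable]: "V \<in> events" unfolding V_def by measurable
  have "emeasure M V \<le> ennreal 4 * (\<integral>\<^sup>+x. z x * indicator (space M) x \<partial>M)"
    unfolding V_def by (rule nn_integral_Markov_inequality) auto
  also have "\<dots> = ennreal 4 * (\<integral>\<^sup>+x. z x \<partial>M)"
    by (intro arg_cong2[where f = "(*)"] nn_integral_cong) auto
  also have "\<dots> \<le> ennreal 4 * ennreal (1 / 8)" using z8 by (intro mult_left_mono) auto
  also have "\<dots> = ennreal (1 / 2)" by (subst ennreal_mult[symmetric]) auto
  finally have "ennreal (prob V) \<le> ennreal (1 / 2)" by (simp only: emeasure_eq_measure)
  then have V2: "prob V \<le> 1 / 2" by (subst (asm) ennreal_le_iff) auto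

  define D where "D = (\<lambda>p q x. \<Sum>j\<in>I. (a p x j - a q x j)\<^sup>2)"
  have Dm[measurable]: "D p q \<in> borel_measurable M" for p q unfolding D_def by measurable
  define U where "U = (\<lambda>(p, q). {x \<in> space M. p \<noteq> q \<and> D p q x < \<epsilon>\<^sup>2})"
  have Um[measurable]: "U pq \<in> events" for pq unfolding U_def by (cases pq) simp
  have DB: "AE x in M. D p q x = B J p q x" for p q
  proof -
    have "AE x in M. \<forall>j\<in>I. T j (h p q) x = T j (S p f) x - T j (S q f) x"
      unfolding h_def using TD(1)[OF I1] by (intro AE_finite_allI I linear_operator_diff) auto
    then show ?thesis
    proof eventually_elim
      case (elim x)
      then have "D p q x = (\<Sum>j\<in>I. (T j (h p q) x)\<^sup>2 / real J)"
        unfolding D_def a_def by (intro sum.cong) (auto simp: power_divide simp flip: diff_divide_distrib)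
      then show ?case by (simp add: B_def I_def sum_divide_distrib)
    qed
  qed
  have iB: "integrable M (B J p q)" for p q
    unfolding B_def
    by (intro integrable_divide Bochner_Integration.integrable_sum isometry_on_L2_square(1)[OF TD(3) hm inth]) auto
  have U1: "prob (U pq) \<le> 1 / (4 * ?N * ?N)" if pq: "pq \<in> A \<times> A" for pq
  proof -
    obtain p q where [simp]: "pq = (p, q)" and pqA: "p \<in> A" "q \<in> A" using pq by auto
    have "prob (U pq) \<le> prob {x \<in> space M. \<epsilon>\<^sup>2 \<le> \<bar>B J p q x - m p q\<bar>}"
    proof (rule finite_measure_mono_AE)
      show "AE x in M. x \<in> U pq \<longrightarrow> x \<in> {x \<in> space M. \<epsilon>\<^sup>2 \<le> \<bar>B J p q x - m p q\<bar>}"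
        using DB[of p q]
      proof eventually_elim
        case (elim x)
        then show ?case using sep[OF pqA] by (auto simp: U_def m_def h_def)
      qed
      show "{x \<in> space M. \<epsilon>\<^sup>2 \<le> \<bar>B J p q x - m p q\<bar>} \<in> events"
        using borel_measurable_integrable[OF iB] by measurable
    qed
    also have "\<dots> \<le> (\<integral>x. \<bar>B J p q x - m p q\<bar> \<partial>M) / \<epsilon>\<^sup>2"
      using iB \<epsilon> by (intro integral_Markov_inequality_measure[where A = "{}"]) auto
    also have "\<dots> \<le> \<eta> / \<epsilon>\<^sup>2" using J1[OF pqA] by (intro divide_right_mono) auto
    also have "\<dots> = 1 / (4 * ?N * ?N)" using \<epsilon> by (simp add: \<eta>_def)
    finally show ?thesis .
  qed
  have "prob (\<Union>pq\<in>A \<times> A. U pq) \<le> (\<Sum>pq\<in>A \<times> A. prob (U pq))"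
    using A by (intro measure_UNION_le) auto
  also have "\<dots> \<le> (\<Sum>pq\<in>A \<times> A. 1 / (4 * ?N * ?N))" by (rule sum_mono[OF U1])
  also have "\<dots> = 1 / 4" using N by (simp add: card_cartesian_product)
  finally have U4: "prob (\<Union>pq\<in>A \<times> A. U pq) \<le> 1 / 4" .
  have "prob (V \<union> (\<Union>pq\<in>A \<times> A. U pq)) \<le> prob V + prob (\<Union>pq\<in>A \<times> A. U pq)"
    using A(1) by (intro measure_Un_le) auto
  then have "prob (V \<union> (\<Union>pq\<in>A \<times> A. U pq)) < prob (space M)" using V2 U4 by (simp add: prob_space)
  then have "V \<union> (\<Union>pq\<in>A \<times> A. U pq) \<noteq> space M" by force
  moreover have "V \<union> (\<Union>pq\<in>A \<times> A. U pq) \<subseteq> space M" by (auto simp: V_def U_def)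
  ultimately obtain x where x: "x \<in> space M" "x \<notin> V" "\<And>p q. p \<in> A \<Longrightarrow> q \<in> A \<Longrightarrow> x \<notin> U (p, q)" by blast

  show ?thesis
  proof (rule sudakov_minoration[OF I A \<epsilon>])
    show "\<epsilon>\<^sup>2 \<le> (\<Sum>i\<in>I. (a p x i - a q x i)\<^sup>2)" if "p \<in> A" "q \<in> A" "p \<noteq> q" for p q
      using x(3)[OF that(1,2)] x(1) that(3) by (auto simp: U_def D_def)
    have Zx: "(\<lambda>g. (g, x)) -` Z \<in> sets (gauss I)" by (rule sets_Pair2[OF Zm])
    have "ennreal 4 * z x < 1" using x(1,2) by (simp add: V_def not_le)
    then have "ennreal (4 * G.prob ((\<lambda>g. (g, x)) -` Z)) < ennreal 1"
      by (simp add: z_def G.emeasure_eq_measure ennreal_mult)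
    then have "4 * G.prob ((\<lambda>g. (g, x)) -` Z) < 1"
      by (subst (asm) ennreal_less_iff) auto
    moreover have "{g \<in> space (gauss I). \<forall>n\<in>A. \<bar>\<Sum>i\<in>I. a n x i * g i\<bar> < R + 1}
        = space (gauss I) - (\<lambda>g. (g, x)) -` Z"
      using x(1) by (auto simp: Z_def space_pair_measure not_le)
    ultimately show "3 / 4 \<le> G.prob {g \<in> space (gauss I). \<forall>n\<in>A. \<bar>\<Sum>i\<in>I. a n x i * g i\<bar> < R + 1}"
      using G.prob_compl[OF Zx] by simp
  qed
qed

text \<open>
  A truncation of \<open>f\<close> has at most the norm of \<open>f\<close> and moves the finitely many functions \<open>S n f\<close>,
  \<open>n \<in> A\<close>, as little as desired; halving the separation pays for it.
\<close>

lemma (in prob_space) orbit_separation_bound_L2: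
  assumes T: "bourgain_sequence M T"
    and lin: "\<And>n. linear_operator M (S n)" and bdd: "\<And>n. bounded_on_Lp M 2 (S n)"
    and comm: "\<And>n j. j \<ge> 1 \<Longrightarrow> operators_commute M (S n) (T j)"
    and R: "\<And>h. h \<in> borel_measurable M \<Longrightarrow> (\<integral>\<^sup>+x. ennreal (cosh (h x)) \<partial>M) \<le> ennreal 48 \<Longrightarrow>
      prob {x \<in> space M. \<exists>n::nat. R < \<bar>S n h x\<bar>} \<le> 1 / 16"
    and f[measurable]: "f \<in> borel_measurable M" and int: "integrable M (\<lambda>x. (f x)\<^sup>2)"
    and le: "(\<integral>x. (f x)\<^sup>2 \<partial>M) \<le> 1"
    and A: "finite A" "A \<noteq> {}" and \<delta>: "\<delta> > 0"
    and sep: "\<And>p q. p \<in> A \<Longrightarrow> q \<in> A \<Longrightarrow> p \<noteq> q \<Longrightarrow> \<delta>\<^sup>2 \<le> (\<integral>x. (S p f x - S q f x)\<^sup>2 \<partial>M)"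
  shows "ln (real (card A)) \<le> 2048 / 3 * (R + 1)\<^sup>2 / \<delta>\<^sup>2"
proof -
  note [measurable] = linear_operator_measurable[OF lin]
  define u where "u = (\<lambda>k x. if \<bar>f x\<bar> \<le> real k then f x else 0)"
  define d where "d = (\<lambda>k x. f x - u k x)"
  have um[measurable]: "u k \<in> borel_measurable M" for k unfolding u_def by measurable
  have dm[measurable]: "d k \<in> borel_measurable M" for k unfolding d_def by measurable
  have ule: "\<bar>u k x\<bar> \<le> \<bar>f x\<bar>" "\<bar>u k x\<bar> \<le> real k" for k x by (auto simp: u_def)
  have dle: "(d k x)\<^sup>2 \<le> (f x)\<^sup>2" "(u k x)\<^sup>2 \<le> (f x)\<^sup>2" for k x by (auto simp: d_def u_def)
  have uint: "integrable M (\<lambda>x. (u k x)\<^sup>2)" and dint: "integrable M (\<lambda>x. (d k x)\<^sup>2)" for k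
    using dle by (auto intro!: Bochner_Integration.integrable_bound[OF int])
  have d0: "(\<lambda>k. \<integral>x. (d k x)\<^sup>2 \<partial>M) \<longlonglongrightarrow> (\<integral>x. 0 \<partial>M)"
  proof (rule integral_dominated_convergence[where w = "\<lambda>x. (f x)\<^sup>2"])
    show "AE x in M. (\<lambda>k. (d k x)\<^sup>2) \<longlonglongrightarrow> 0"
    proof (rule AE_I2, rule tendsto_eventually)
      fix x
      obtain k where "\<bar>f x\<bar> \<le> real k" using real_arch_simple by blast
      then have "\<forall>l\<ge>k. (d l x)\<^sup>2 = 0" by (auto simp: d_def u_def)
      then show "\<forall>\<^sub>F k in sequentially. (d k x)\<^sup>2 = 0" by (auto simp: eventually_sequentially)
    qed
  qed (use int dle in auto)
  have "\<forall>n\<in>A. \<forall>\<^sub>F k in sequentially. (\<integral>x. (S n (d k) x)\<^sup>2 \<partial>M) < \<delta>\<^sup>2 / 16"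
  proof
    fix n
    obtain K where K: "\<And>h :: 'a \<Rightarrow> real. h \<in> borel_measurable M \<Longrightarrow> integrable M (\<lambda>x. (h x)\<^sup>2) \<Longrightarrow>
        integrable M (\<lambda>x. (S n h x)\<^sup>2) \<and> (\<integral>x. (S n h x)\<^sup>2 \<partial>M) \<le> K * (\<integral>x. (h x)\<^sup>2 \<partial>M)"
      using bounded_on_L2_square[OF bdd[of n]] by metis
    have "(\<lambda>k. K * (\<integral>x. (d k x)\<^sup>2 \<partial>M)) \<longlonglongrightarrow> 0"
      using d0 by (intro tendsto_mult_right_zero) simp
    then have "\<forall>\<^sub>F k in sequentially. K * (\<integral>x. (d k x)\<^sup>2 \<partial>M) < \<delta>\<^sup>2 / 16"
      using \<delta> by (intro order_tendstoD) auto
    then show "\<forall>\<^sub>F k in sequentially. (\<integral>x. (S n (d k) x)\<^sup>2 \<partial>M) < \<delta>\<^sup>2 / 16"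
    proof eventually_elim
      case (elim k)
      with K[OF dm[of k] dint[of k]] show ?case by (meson le_less_trans)
    qed
  qed
  then have "\<forall>\<^sub>F k in sequentially. \<forall>n\<in>A. (\<integral>x. (S n (d k) x)\<^sup>2 \<partial>M) < \<delta>\<^sup>2 / 16"
    by (rule eventually_ball_finite[OF A(1)])
  then obtain k where k: "\<And>n. n \<in> A \<Longrightarrow> (\<integral>x. (S n (d k) x)\<^sup>2 \<partial>M) < \<delta>\<^sup>2 / 16"
    unfolding eventually_sequentially by blast
  have iS: "integrable M (\<lambda>x. (S n g x)\<^sup>2)" if "g \<in> borel_measurable M" "integrable M (\<lambda>x. (g x)\<^sup>2)" for n g
    using bounded_on_L2_square[OF bdd[of n]] that by metis
  have "ln (real (card A)) \<le> 256 / 3 * (R + 1)\<^sup>2 / (\<delta> / sqrt 8)\<^sup>2"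
  proof (rule orbit_separation_bound[OF T lin bdd comm R um ule(2) _ A])
    have "(\<integral>x. (u k x)\<^sup>2 \<partial>M) \<le> (\<integral>x. (f x)\<^sup>2 \<partial>M)" using uint int dle by (intro integral_mono) auto
    then show "(\<integral>x. (u k x)\<^sup>2 \<partial>M) \<le> 1" using le by simp
    show "0 < \<delta> / sqrt 8" using \<delta> by simp
    fix p q assume pq: "p \<in> A" "q \<in> A" "p \<noteq> q"
    have S: "AE x in M. S n f x = S n (u k) x + S n (d k) x" for n
    proof -
      have "AE x in M. S n (\<lambda>y. u k y + d k y) x = S n (u k) x + S n (d k) x"
        by (rule linear_operator_add[OF lin]) measurable
      then show ?thesis by (simp add: d_def)
    qed
    have idiff: "integrable M (\<lambda>x. (S p (u k) x - S q (u k) x)\<^sup>2)"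
      by (intro integrable_square_diff iS uint) measurable
    have "(\<integral>x. (S p f x - S q f x)\<^sup>2 \<partial>M) \<le> (\<integral>x. 2 * (S p (u k) x - S q (u k) x)\<^sup>2
        + (4 * (S p (d k) x)\<^sup>2 + 4 * (S q (d k) x)\<^sup>2) \<partial>M)"
    proof (rule integral_mono_AE)
      show "integrable M (\<lambda>x. (S p f x - S q f x)\<^sup>2)"
        by (intro integrable_square_diff iS int) measurable
      show "integrable M (\<lambda>x. 2 * (S p (u k) x - S q (u k) x)\<^sup>2 + (4 * (S p (d k) x)\<^sup>2 + 4 * (S q (d k) x)\<^sup>2))"
        using idiff iS[OF dm dint] by auto
      show "AE x in M. (S p f x - S q f x)\<^sup>2 \<le> 2 * (S p (u k) x - S q (u k) x)\<^sup>2
          + (4 * (S p (d k) x)\<^sup>2 + 4 * (S q (d k) x)\<^sup>2)"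
        using S[of p] S[of q]
      proof eventually_elim
        case (elim x)
        have *: "(v + (s - t))\<^sup>2 \<le> 2 * v\<^sup>2 + (4 * s\<^sup>2 + 4 * t\<^sup>2)" for v s t :: real
          using zero_le_power2[of "v - (s - t)"] zero_le_power2[of "s + t"]
          by (simp add: power2_eq_square algebra_simps)
        show ?case using *[of "S p (u k) x - S q (u k) x" "S p (d k) x" "S q (d k) x"]
          unfolding elim by (simp add: algebra_simps)
      qed
    qed
    also have "\<dots> = 2 * (\<integral>x. (S p (u k) x - S q (u k) x)\<^sup>2 \<partial>M)
        + (4 * (\<integral>x. (S p (d k) x)\<^sup>2 \<partial>M) + 4 * (\<integral>x. (S q (d k) x)\<^sup>2 \<partial>M))"
      using idiff iS[OF dm dint] by simp
    finally have "\<delta>\<^sup>2 / 4 \<le> (\<integral>x. (S p (u k) x - S q (u k) x)\<^sup>2 \<partial>M)"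
      using sep[OF pq] k[OF pq(1)] k[OF pq(2)] by linarith
    then show "2 * (\<delta> / sqrt 8)\<^sup>2 \<le> (\<integral>x. (S p (u k) x - S q (u k) x)\<^sup>2 \<partial>M)"
      by (simp add: power_divide)
  qed
  also have "\<dots> = 2048 / 3 * (R + 1)\<^sup>2 / \<delta>\<^sup>2" by (simp add: power_divide)
  finally show ?thesis .
qed

section \<open>The entropy bound\<close>

text \<open>
  A separated set of maximal cardinality is a covering, since any point that it fails to cover
  could be added to it.
\<close>

lemma entropy_number_le_separated:
  fixes d :: "'b \<Rightarrow> 'b \<Rightarrow> real"
  assumes refl: "\<And>y. y \<in> Y \<Longrightarrow> d y y \<le> \<delta>" and sym: "\<And>x y. d x y = d y x"
    and bound: "\<And>A. finite A \<Longrightarrow> A \<subseteq> Y \<Longrightarrow> (\<And>p q. p \<in> A \<Longrightarrow> q \<in> A \<Longrightarrow> p \<noteq> q \<Longrightarrow> \<delta> < d p q) \<Longrightarrow> card A \<le> L"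
  obtains A where "finite A" "A \<subseteq> Y" "\<And>p q. p \<in> A \<Longrightarrow> q \<in> A \<Longrightarrow> p \<noteq> q \<Longrightarrow> \<delta> < d p q"
    and "entropy_number Y d Y \<delta> \<le> enat (card A)"
proof -
  define P where "P = (\<lambda>A. finite A \<and> A \<subseteq> Y \<and> (\<forall>p\<in>A. \<forall>q\<in>A. p \<noteq> q \<longrightarrow> \<delta> < d p q))"
  have "P {}" by (simp add: P_def)
  moreover have "\<forall>A. P A \<longrightarrow> card A < Suc L" using bound unfolding P_def by (metis less_Suc_eq_le)
  ultimately obtain A where A: "P A" and max: "\<And>A'. P A' \<Longrightarrow> card A' \<le> card A"
    using ex_has_greatest_nat[of P "{}" card "Suc L"] by blast
  have fA: "finite A" "A \<subseteq> Y" using A by (auto simp: P_def)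
  have "Y \<subseteq> (\<Union>c\<in>A. {y \<in> Y. d c y \<le> \<delta>})"
  proof
    fix y assume y: "y \<in> Y"
    show "y \<in> (\<Union>c\<in>A. {y \<in> Y. d c y \<le> \<delta>})"
    proof (rule ccontr)
      assume no: "\<not> ?thesis"
      then have far: "\<delta> < d c y" if "c \<in> A" for c using that y by (auto simp: not_le)
      then have yA: "y \<notin> A" using refl[OF y] by force
      have "P (insert y A)" unfolding P_def
      proof (intro conjI ballI impI)
        fix p q assume "p \<in> insert y A" "q \<in> insert y A" "p \<noteq> q"
        then consider "p \<in> A" "q \<in> A" | "p = y" "q \<in> A" | "p \<in> A" "q = y" by blast
        then show "\<delta> < d p q"
        proof cases
          case 1 then show ?thesis using A \<open>p \<noteq> q\<close> by (simp add: P_def)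
        next
          case 2 then show ?thesis using far[of q] sym[of q y] by simp
        next
          case 3 then show ?thesis using far[of p] by simp
        qed
      qed (use fA y in auto)
      from max[OF this] show False using yA fA by simp
    qed
  qed
  then have "entropy_number Y d Y \<delta> \<le> enat (card A)"
    unfolding entropy_number_def using fA by (intro Inf_lower) blast
  then show thesis using that[OF fA] A by (simp add: P_def)
qed

lemma SUP_ereal_finite_bounded:
  assumes "I \<noteq> {}" and "(SUP n\<in>I. ereal \<bar>u n\<bar>) < \<infinity>"
  shows "\<exists>B. \<forall>n\<in>I. \<bar>u n\<bar> \<le> B"
proof -
  let ?s = "SUP n\<in>I. ereal \<bar>u n\<bar>"
  obtain m where "m \<in> I" using assms(1) by blast
  then have "ereal 0 \<le> ?s" by (intro SUP_upper2[of m]) auto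
  then obtain B where B: "?s = ereal B" using assms(2) by (cases ?s) auto
  have "ereal \<bar>u n\<bar> \<le> ereal B" if "n \<in> I" for n
    unfolding B[symmetric] using that by (rule SUP_upper)
  then show ?thesis by auto
qed

theorem proposition1:
  fixes M :: "'a measure"
    and S T :: "nat \<Rightarrow> ('a \<Rightarrow> real) \<Rightarrow> 'a \<Rightarrow> real"
    and p :: real
  assumes "prob_space M"
    and "\<And>n. n \<ge> 1 \<Longrightarrow> linear_operator M (S n)"
    and "\<And>n. n \<ge> 1 \<Longrightarrow> bounded_on_Lp M 2 (S n)"
    and "bourgain_sequence M T"
    and "\<And>n j. n \<ge> 1 \<Longrightarrow> j \<ge> 1 \<Longrightarrow> operators_commute M (S n) (T j)"
    and "1 \<le> p"
    and "\<And>f. f \<in> Lp_space M p \<Longrightarrow> AE x in M. (SUP n\<in>{1..}. ereal \<bar>S n f x\<bar>) < \<infinity>"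
  shows "\<exists>C>0. \<forall>\<delta>>0. \<forall>f \<in> Lp_space M 2.
           orbit_entropy M S f \<delta> < \<infinity> \<and>
           \<delta> * sqrt (ln (real (the_enat (orbit_entropy M S f \<delta>)))) \<le> C * Lp_norm M 2 f"
proof -
  interpret prob_space M by fact
  \<comment> \<open>Redefining \<open>S 0\<close> as \<open>S 1\<close> makes the hypotheses available for all indices.\<close>
  define S' where "S' = (\<lambda>n. S (max 1 n))"
  have lin: "linear_operator M (S' n)" and bdd: "bounded_on_Lp M 2 (S' n)" for n
    unfolding S'_def using assms(2,3) by auto
  have comm: "operators_commute M (S' n) (T j)" if "j \<ge> 1" for n j
    unfolding S'_def using assms(5) that by auto
  have fin: "AE x in M. \<exists>B. \<forall>n. \<bar>S' n f x\<bar> \<le> B"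
    if "f \<in> borel_measurable M" "(\<integral>\<^sup>+x. ennreal (cosh (f x)) \<partial>M) < \<infinity>" for f
  proof -
    have p0: "0 < p" using assms(6) by simp
    show ?thesis using assms(7)[OF cosh_integrable_Lp[OF p0 that]]
    proof eventually_elim
      case (elim x)
      obtain B where "\<forall>n\<in>{1..}. \<bar>S n f x\<bar> \<le> B" using SUP_ereal_finite_bounded[OF _ elim] by auto
      then show ?case by (intro exI[of _ B]) (simp add: S'_def)
    qed
  qed
  obtain R where R: "\<And>h. h \<in> borel_measurable M \<Longrightarrow> (\<integral>\<^sup>+x. ennreal (cosh (h x)) \<partial>M) \<le> ennreal 48 \<Longrightarrow>
      prob {x \<in> space M. \<exists>n. R < \<bar>S' n h x\<bar>} \<le> 1 / 16"
    using banach_principle[where S = S' and C = 48 and \<epsilon> = "1 / 16", OF lin bdd fin] by auto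
  \<comment> \<open>The summand \<open>1\<close> only ensures that \<open>C\<close> is positive.\<close>
  define C where "C = sqrt (2048 / 3) * \<bar>R + 1\<bar> + 1"
  have C: "C > 0" by (simp add: C_def add_nonneg_pos)
  have main: "\<delta> * sqrt (ln (real (card A))) \<le> C * b"
    if \<delta>: "\<delta> > 0" and f: "f \<in> Lp_space M 2" and b: "Lp_norm M 2 f < b" and A: "finite A" "A \<subseteq> {1..}"
      and sep: "\<And>p q. p \<in> A \<Longrightarrow> q \<in> A \<Longrightarrow> p \<noteq> q \<Longrightarrow> \<delta> < orbit_dist M S f p q" for \<delta> f b A
  proof (cases "A = {}")
    case True
    have "0 \<le> b" using b by (simp add: Lp_norm_def order_trans[OF powr_ge_zero less_imp_le])
    then show ?thesis using True C by simp
  next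
    case False
    have fm[measurable]: "f \<in> borel_measurable M" and int: "integrable M (\<lambda>x. (f x)\<^sup>2)"
      using f by (auto simp: Lp_space_2)
    note [measurable] = linear_operator_measurable[OF lin]
    have sq: "sqrt (\<integral>x. (f x)\<^sup>2 \<partial>M) < b" using b by (simp add: Lp_norm_2)
    have b0: "0 < b" using le_less_trans[OF _ sq, of 0] by (simp add: integral_nonneg_AE)
    have fb: "(\<integral>x. (f x)\<^sup>2 \<partial>M) \<le> b\<^sup>2"
      using sq by (simp add: real_sqrt_less_iff real_less_lsqrt sqrt_le_D less_imp_le)
    define g where "g = (\<lambda>x. (1 / b) * f x)"
    have gm[measurable]: "g \<in> borel_measurable M" unfolding g_def by measurable
    have g2: "(g x)\<^sup>2 = (f x)\<^sup>2 / b\<^sup>2" for x by (simp add: g_def power_divide)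
    have "ln (real (card A)) \<le> 2048 / 3 * (R + 1)\<^sup>2 / (\<delta> / b)\<^sup>2"
    proof (rule orbit_separation_bound_L2[OF assms(4) lin bdd comm R gm _ _ A(1) False])
      show "integrable M (\<lambda>x. (g x)\<^sup>2)" unfolding g2 using int by simp
      show "(\<integral>x. (g x)\<^sup>2 \<partial>M) \<le> 1" unfolding g2 using fb b0 by simp
      show "0 < \<delta> / b" using \<delta> b0 by simp
      fix p q assume pq: "p \<in> A" "q \<in> A" "p \<noteq> q"
      have S: "AE x in M. S' n g x = (1 / b) * S' n f x" for n
        unfolding g_def by (rule linear_operator_scale[OF lin fm])
      have "(\<integral>x. (S' p g x - S' q g x)\<^sup>2 \<partial>M) = (\<integral>x. (S' p f x - S' q f x)\<^sup>2 / b\<^sup>2 \<partial>M)"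
      proof (rule integral_cong_AE)
        show "AE x in M. (S' p g x - S' q g x)\<^sup>2 = (S' p f x - S' q f x)\<^sup>2 / b\<^sup>2"
          using S[of p] S[of q] by eventually_elim (simp add: power_divide flip: diff_divide_distrib)
      qed measurable
      also have "\<dots> = (orbit_dist M S f p q)\<^sup>2 / b\<^sup>2"
        using A(2) pq by (auto simp: orbit_dist_def Lp_norm_2 S'_def max_absorb2 subset_iff integral_nonneg_AE)
      finally have "(\<integral>x. (S' p g x - S' q g x)\<^sup>2 \<partial>M) = (orbit_dist M S f p q / b)\<^sup>2" by (simp add: power_divide)
      moreover have "(\<delta> / b)\<^sup>2 \<le> (orbit_dist M S f p q / b)\<^sup>2"
        using sep[OF pq] \<delta> b0 by (intro power_mono divide_right_mono) auto
      ultimately show "(\<delta> / b)\<^sup>2 \<le> (\<integral>x. (S' p g x - S' q g x)\<^sup>2 \<partial>M)" by simp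
    qed
    then have "sqrt (ln (real (card A))) \<le> sqrt (2048 / 3 * (R + 1)\<^sup>2 / (\<delta> / b)\<^sup>2)" by (rule real_sqrt_le_mono)
    also have "\<dots> = sqrt (2048 / 3) * \<bar>R + 1\<bar> / (\<delta> / b)"
      using \<delta> b0 by (simp add: real_sqrt_mult real_sqrt_divide)
    finally have "\<delta> * sqrt (ln (real (card A))) \<le> \<delta> * (sqrt (2048 / 3) * \<bar>R + 1\<bar> / (\<delta> / b))"
      using \<delta> by (intro mult_left_mono) auto
    also have "\<dots> = sqrt (2048 / 3) * \<bar>R + 1\<bar> * b" using \<delta> by simp
    also have "\<dots> \<le> C * b" using b0 by (intro mult_right_mono) (auto simp: C_def)
    finally show ?thesis .
  qed
  show ?thesis
  proof (intro exI[of _ C] conjI allI impI ballI C)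
    fix \<delta> :: real and f assume \<delta>: "0 < \<delta>" and f: "f \<in> Lp_space M 2"
    let ?b = "Lp_norm M 2 f + 1"
    have bound: "card A \<le> nat \<lceil>exp ((C * ?b / \<delta>)\<^sup>2)\<rceil>" if "finite A" "A \<subseteq> {1..}"
      "\<And>p q. p \<in> A \<Longrightarrow> q \<in> A \<Longrightarrow> p \<noteq> q \<Longrightarrow> \<delta> < orbit_dist M S f p q" for A
    proof (cases "card A = 0")
      case False
      then have c: "1 \<le> real (card A)" by simp
      have "\<delta> * sqrt (ln (real (card A))) \<le> C * ?b" by (rule main[OF \<delta> f _ that]) simp_all
      then have "sqrt (ln (real (card A))) \<le> C * ?b / \<delta>" using \<delta> by (simp add: field_simps)
      then have "ln (real (card A)) \<le> (C * ?b / \<delta>)\<^sup>2" by (rule sqrt_le_D)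
      then have "exp (ln (real (card A))) \<le> exp ((C * ?b / \<delta>)\<^sup>2)" by simp
      then have "real (card A) \<le> exp ((C * ?b / \<delta>)\<^sup>2)" using c by simp
      then show ?thesis by linarith
    qed simp
    obtain A where A: "finite A" "A \<subseteq> {1..}"
      "\<And>p q. p \<in> A \<Longrightarrow> q \<in> A \<Longrightarrow> p \<noteq> q \<Longrightarrow> \<delta> < orbit_dist M S f p q"
      and ent: "orbit_entropy M S f \<delta> \<le> enat (card A)"
      unfolding orbit_entropy_def
    proof (rule entropy_number_le_separated[of "{1..}" "orbit_dist M S f" \<delta>])
      show "orbit_dist M S f y y \<le> \<delta>" for y using \<delta> by (simp add: orbit_dist_def Lp_norm_2)
      show "orbit_dist M S f x y = orbit_dist M S f y x" for x y
        unfolding orbit_dist_def Lp_norm_2 by (simp add: power2_commute)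
      show "card A \<le> nat \<lceil>exp ((C * ?b / \<delta>)\<^sup>2)\<rceil>" if "finite A" "A \<subseteq> {1..}"
        "\<And>p q. p \<in> A \<Longrightarrow> q \<in> A \<Longrightarrow> p \<noteq> q \<Longrightarrow> \<delta> < orbit_dist M S f p q" for A
        by (rule bound[OF that])
    qed (rule that[unfolded orbit_entropy_def])
    show "orbit_entropy M S f \<delta> < \<infinity>" using ent by (rule le_less_trans) simp
    then obtain k where k: "orbit_entropy M S f \<delta> = enat k" by (cases "orbit_entropy M S f \<delta>") auto
    have "ln (real k) \<le> ln (real (card A))"
    proof (cases "k = 0")
      case False
      then show ?thesis using ent k by simp
    qed (cases "card A = 0", auto)
    then have k': "\<delta> * sqrt (ln (real k)) \<le> \<delta> * sqrt (ln (real (card A)))"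
      using \<delta> by (intro mult_left_mono) auto
    \<comment> \<open>Letting \<open>b\<close> decrease to the norm covers the case of norm zero as well.\<close>
    have "\<delta> * sqrt (ln (real k)) / C \<le> Lp_norm M 2 f"
    proof (rule dense_ge)
      fix b assume b: "Lp_norm M 2 f < b"
      have "\<delta> * sqrt (ln (real (card A))) \<le> C * b" by (rule main[OF \<delta> f b A])
      with k' have "\<delta> * sqrt (ln (real k)) \<le> C * b" by (rule order_trans)
      then show "\<delta> * sqrt (ln (real k)) / C \<le> b" using C by (simp add: field_simps)
    qed
    then show "\<delta> * sqrt (ln (real (the_enat (orbit_entropy M S f \<delta>)))) \<le> C * Lp_norm M 2 f"
      using C k by (simp add: field_simps)
  qed
qed

end
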